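(* Let $\Omega$ be an infinite set. Then there exists a $0,1$-lattice embedding (a one-to-one lattice homomorphism preserving least and greatest elements) from $(\operatorname{Eq}\Omega)\amalg(\operatorname{Eq}\Omega)$ into $\operatorname{Eq}\Omega$.
   Context: $\operatorname{Eq}\Omega$ denotes the lattice of all equivalence relations on the set $\Omega$, ordered by inclusion. For lattices $L_1,L_2$, $L_1\amalg L_2$ denotes their coproduct (free product) in the variety of all lattices (with lattice homomorphisms). *)

theory Defs
  imports Main
begin

definition EqL :: "'a rel set" where
  "EqL = {R. equiv UNIV R}"

definition eq_join :: "'a rel \<Rightarrow> 'a rel \<Rightarrow> 'a rel" where
  "eq_join R S = trancl (R \<union> S)"

definition eq_meet :: "'a rel \<Rightarrow> 'a rel \<Rightarrow> 'a rel" where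
  "eq_meet R S = R \<inter> S"

datatype 'g lterm = Gen 'g | Join "'g lterm" "'g lterm" | Meet "'g lterm" "'g lterm"

fun valid_term :: "('a rel + 'a rel) lterm \<Rightarrow> bool" where
  "valid_term (Gen (Inl R)) = (R \<in> EqL)"
| "valid_term (Gen (Inr R)) = (R \<in> EqL)"
| "valid_term (Join t s) = (valid_term t \<and> valid_term s)"
| "valid_term (Meet t s) = (valid_term t \<and> valid_term s)"

text \<open>The coproduct (free product) Eq(Omega) \<amalg> Eq(Omega) in the variety of all lattices,
  presented by generators and relations: lattice terms over the disjoint union of the
  two copies, modulo the smallest lattice congruence containing the lattice laws and the
  operation tables of both factors.\<close>

inductive coprod_eq :: "('a rel + 'a rel) lterm \<Rightarrow> ('a rel + 'a rel) lterm \<Rightarrow> bool" where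
  ce_refl: "coprod_eq t t"
| ce_sym: "coprod_eq t s \<Longrightarrow> coprod_eq s t"
| ce_trans: "coprod_eq t s \<Longrightarrow> coprod_eq s u \<Longrightarrow> coprod_eq t u"
| ce_join: "coprod_eq t t' \<Longrightarrow> coprod_eq s s' \<Longrightarrow> coprod_eq (Join t s) (Join t' s')"
| ce_meet: "coprod_eq t t' \<Longrightarrow> coprod_eq s s' \<Longrightarrow> coprod_eq (Meet t s) (Meet t' s')"
| ce_join_comm: "coprod_eq (Join t s) (Join s t)"
| ce_meet_comm: "coprod_eq (Meet t s) (Meet s t)"
| ce_join_assoc: "coprod_eq (Join (Join t s) u) (Join t (Join s u))"
| ce_meet_assoc: "coprod_eq (Meet (Meet t s) u) (Meet t (Meet s u))"
| ce_join_idem: "coprod_eq (Join t t) t"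
| ce_meet_idem: "coprod_eq (Meet t t) t"
| ce_absorb1: "coprod_eq (Join t (Meet t s)) t"
| ce_absorb2: "coprod_eq (Meet t (Join t s)) t"
| ce_inl_join: "R \<in> EqL \<Longrightarrow> S \<in> EqL \<Longrightarrow>
      coprod_eq (Join (Gen (Inl R)) (Gen (Inl S))) (Gen (Inl (eq_join R S)))"
| ce_inl_meet: "R \<in> EqL \<Longrightarrow> S \<in> EqL \<Longrightarrow>
      coprod_eq (Meet (Gen (Inl R)) (Gen (Inl S))) (Gen (Inl (eq_meet R S)))"
| ce_inr_join: "R \<in> EqL \<Longrightarrow> S \<in> EqL \<Longrightarrow>
      coprod_eq (Join (Gen (Inr R)) (Gen (Inr S))) (Gen (Inr (eq_join R S)))"
| ce_inr_meet: "R \<in> EqL \<Longrightarrow> S \<in> EqL \<Longrightarrow>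
      coprod_eq (Meet (Gen (Inr R)) (Gen (Inr S))) (Gen (Inr (eq_meet R S)))"

definition coprod_bot :: "('a rel + 'a rel) lterm" where
  "coprod_bot = Meet (Gen (Inl Id)) (Gen (Inr Id))"

definition coprod_top :: "('a rel + 'a rel) lterm" where
  "coprod_top = Join (Gen (Inl UNIV)) (Gen (Inr UNIV))"

text \<open>h (a map on representing terms) induces a 0,1-lattice embedding of the coproduct
  into Eq(Omega): it is well defined and injective on classes, lands in Eq(Omega),
  preserves joins and meets, and sends bottom/top to Id/UNIV.\<close>

definition coprod_01_embedding :: "(('a rel + 'a rel) lterm \<Rightarrow> 'a rel) \<Rightarrow> bool" where
  "coprod_01_embedding h \<longleftrightarrow>
     (\<forall>t. valid_term t \<longrightarrow> h t \<in> EqL) \<and>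
     (\<forall>t s. valid_term t \<longrightarrow> valid_term s \<longrightarrow> (h t = h s \<longleftrightarrow> coprod_eq t s)) \<and>
     (\<forall>t s. valid_term t \<longrightarrow> valid_term s \<longrightarrow> h (Join t s) = eq_join (h t) (h s)) \<and>
     (\<forall>t s. valid_term t \<longrightarrow> valid_term s \<longrightarrow> h (Meet t s) = eq_meet (h t) (h s)) \<and>
     h coprod_bot = Id \<and> h coprod_top = UNIV"

end

(* Equivalence relations are directed unions of finitely supported ones, and these form a lattice K
   of cardinality card Omega. The order of a coproduct has a cut-free (Whitman style) description,
   from which one reads off that t(R1,...,Rn) lies below s as soon as all t(F1,...,Fn) with finite
   Fi <= Ri do. Hence t |-> {m. m <= t(F1,...,Fn) for some finite Fi <= Ri} embeds the coproduct in
   the lattice of ideals of the coproduct of K with itself. An ideal lattice of a lattice of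
   cardinality card Omega embeds in Eq Omega by Whitman's construction: take a tree with an edge
   labelled m for each m, glue a path labelled a, b, a, b onto each edge whose label is below the join
   of a and b, repeat, and send an ideal I to the relation of being connected by edges with labels
   in I. *)

theory Submission
  imports Defs
begin

section \<open>The order of the coproduct\<close>

text \<open>For infinite Omega the lattice \<open>EqL\<close> has 2^|Omega| elements, so a graph
  with a label for every element of the coproduct would have too many vertices; finitely supported
  relations bring the number down to |Omega|. The price is that approximation must reflect the
  order. The congruence \<open>coprod_eq\<close> gives no hold on this, as transitivity may lead
  through arbitrary terms. In cut-free form a failure of \<open>le t s\<close> has finitely many
  causes, and only the comparison of covers involves the relations themselves. Why the path is a, b,
  a, b: on an edge labelled c from x to y, let I contain a and c but not b, and J contain b and c
  but not a. On a path a, b with inner vertex z, both I and J identify z with x; on a path a, b, a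
  both identify the two inner vertices; yet neither a nor b is in I \<inter> J, so meets would be
  lost. With inner vertices z1, z2, z3, I gives the classes {x, z1, y}, {z2, z3} and J gives {z1,
  z2}, {z3, y, x}, which agree only on the pair x, y, as they should.\<close>

definition carrier_rel :: "'b + 'b \<Rightarrow> 'b" where
  "carrier_rel g = (case g of Inl R \<Rightarrow> R | Inr R \<Rightarrow> R)"

lemma carrier_rel_simps [simp]:
  "carrier_rel (Inl R) = R" "carrier_rel (Inr R) = R"
  "carrier_rel (map_sum f f g) = f (carrier_rel g)"
  by (auto simp: carrier_rel_def split: sum.split)

declare isl_map_sum [simp]

text \<open>\<open>upper i t\<close> is the least element of the \<open>i\<close>-th factor above \<open>t\<close> (\<open>None\<close> if there is none),
  and \<open>lower i t\<close> is the greatest one below \<open>t\<close>; \<open>i = True\<close> denotes the left factor.\<close>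

primrec upper :: "bool \<Rightarrow> ('a rel + 'a rel) lterm \<Rightarrow> 'a rel option" where
  "upper i (Gen g) = (if isl g = i then Some (carrier_rel g) else None)"
| "upper i (Join t s) =
     (case upper i t of None \<Rightarrow> None | Some A \<Rightarrow> map_option (eq_join A) (upper i s))"
| "upper i (Meet t s) =
     (case upper i t of None \<Rightarrow> upper i s
      | Some A \<Rightarrow> (case upper i s of None \<Rightarrow> Some A | Some B \<Rightarrow> Some (eq_meet A B)))"

primrec lower :: "bool \<Rightarrow> ('a rel + 'a rel) lterm \<Rightarrow> 'a rel option" where
  "lower i (Gen g) = (if isl g = i then Some (carrier_rel g) else None)"
| "lower i (Join t s) =
     (case lower i t of None \<Rightarrow> lower i s
      | Some A \<Rightarrow> (case lower i s of None \<Rightarrow> Some A | Some B \<Rightarrow> Some (eq_join A B)))"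
| "lower i (Meet t s) =
     (case lower i t of None \<Rightarrow> None | Some A \<Rightarrow> map_option (eq_meet A) (lower i s))"

text \<open>A cut-free presentation of the order of the coproduct: transitivity is a theorem, and every
  rule but the first decomposes one of the two terms.\<close>

inductive le :: "('a rel + 'a rel) lterm \<Rightarrow> ('a rel + 'a rel) lterm \<Rightarrow> bool" where
  le_cover: "upper i t = Some A \<Longrightarrow> lower i s = Some B \<Longrightarrow> A \<subseteq> B \<Longrightarrow> le t s"
| le_Join_left: "le t u \<Longrightarrow> le s u \<Longrightarrow> le (Join t s) u"
| le_Meet_right: "le u t \<Longrightarrow> le u s \<Longrightarrow> le u (Meet t s)"
| le_Meet_left1: "le t u \<Longrightarrow> le (Meet t s) u"
| le_Meet_left2: "le s u \<Longrightarrow> le (Meet t s) u"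
| le_Join_right1: "le u t \<Longrightarrow> le u (Join t s)"
| le_Join_right2: "le u s \<Longrightarrow> le u (Join t s)"

section \<open>Covers, and transitivity of the cut-free order\<close>

lemma eq_join_mono: "A \<subseteq> B \<Longrightarrow> C \<subseteq> D \<Longrightarrow> eq_join A C \<subseteq> eq_join B D"
  unfolding eq_join_def by (rule trancl_mono_subset) blast

lemma eq_join_upper1: "A \<subseteq> B \<Longrightarrow> A \<subseteq> eq_join B C"
  unfolding eq_join_def by auto

lemma eq_join_upper2: "A \<subseteq> C \<Longrightarrow> A \<subseteq> eq_join B C"
  unfolding eq_join_def by auto

lemma eq_join_least:
  assumes "C \<in> EqL" "A \<subseteq> C" "B \<subseteq> C"
  shows "eq_join A B \<subseteq> C"
proof -
  have "eq_join A B \<subseteq> C\<^sup>+"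
    unfolding eq_join_def using assms by (intro trancl_mono_subset) blast
  then show ?thesis using assms(1) by (simp add: EqL_def equiv_def)
qed

lemma eq_join_EqL: "A \<in> EqL \<Longrightarrow> B \<in> EqL \<Longrightarrow> eq_join A B \<in> EqL"
  unfolding EqL_def eq_join_def equiv_def
  by (auto intro!: sym_trancl sym_Un refl_onI r_into_trancl dest: refl_onD)

lemma eq_meet_EqL: "A \<in> EqL \<Longrightarrow> B \<in> EqL \<Longrightarrow> eq_meet A B \<in> EqL"
  unfolding EqL_def eq_meet_def equiv_def
  by (auto simp: refl_on_def intro: sym_Int trans_Int)

lemma valid_Gen [simp]: "valid_term (Gen g) \<longleftrightarrow> carrier_rel g \<in> EqL"
  by (cases g) auto

lemma upper_EqL: "valid_term t \<Longrightarrow> upper i t = Some A \<Longrightarrow> A \<in> EqL"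
  by (induction t arbitrary: A)
    (auto split: option.splits if_splits intro: eq_join_EqL eq_meet_EqL)

lemma lower_EqL: "valid_term t \<Longrightarrow> lower i t = Some A \<Longrightarrow> A \<in> EqL"
  by (induction t arbitrary: A)
    (auto split: option.splits if_splits intro: eq_join_EqL eq_meet_EqL)

text \<open>The coproduct identifies neither the least nor the greatest elements of the two factors,
  so no term lies above an element of one and below an element of the other. This lets
  \<open>le_cover\<close> compose with known bounds in the next two lemmas.\<close>

lemma lower_upper:
  "upper i t = Some A \<Longrightarrow> lower j t = Some B \<Longrightarrow> i = j \<and> B \<subseteq> A"
proof (induction t arbitrary: A B)
  case (Gen g) then show ?case by (auto split: if_splits)
next
  case (Join t s)
  then obtain A1 A2 where A: "upper i t = Some A1" "upper i s = Some A2" "A = eq_join A1 A2"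
    by (auto split: option.splits)
  show ?case
    using Join.IH(1)[OF A(1)] Join.IH(2)[OF A(2)] Join.prems(2) A(3)
    by (auto split: option.splits simp: eq_join_upper1 eq_join_upper2
        dest: eq_join_mono[THEN subsetD, rotated 2])
next
  case (Meet t s)
  then obtain B1 B2 where B: "lower j t = Some B1" "lower j s = Some B2" "B = eq_meet B1 B2"
    by (auto split: option.splits)
  show ?case
    using Meet.IH(1)[OF _ B(1)] Meet.IH(2)[OF _ B(2)] Meet.prems(1) B(3)
    by (auto split: option.splits simp: eq_meet_def)
qed

text \<open>With a generator for \<open>s\<close> this says that \<open>upper\<close> yields the
  least bound in its factor. Validity of \<open>s\<close> makes \<open>B\<close> an equivalence, so
  that it absorbs joins of smaller relations.\<close>

lemma le_upper:
  "le t s \<Longrightarrow> valid_term s \<Longrightarrow> upper i s = Some B \<Longrightarrow> \<exists>A. upper i t = Some A \<and> A \<subseteq> B"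
proof (induction arbitrary: B rule: le.induct)
  case (le_cover j t A s C)
  then show ?case using lower_upper by blast
next
  case (le_Join_left t u s)
  then obtain A1 A2 where "upper i t = Some A1" "A1 \<subseteq> B" "upper i s = Some A2" "A2 \<subseteq> B"
    by blast
  moreover have "B \<in> EqL" using upper_EqL le_Join_left.prems by blast
  ultimately show ?case using eq_join_least[of B A1 A2] by auto
next
  case (le_Meet_right u t s)
  show ?case
  proof (cases "upper i t")
    case None then show ?thesis using le_Meet_right by auto
  next
    case (Some B1)
    then obtain A where A: "upper i u = Some A" "A \<subseteq> B1" using le_Meet_right by auto
    then show ?thesis using le_Meet_right Some
      by (cases "upper i s") (auto simp: eq_meet_def)
  qed
next
  case (le_Meet_left1 t u s)
  then obtain A where "upper i t = Some A" "A \<subseteq> B" by blast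
  then show ?case by (cases "upper i s") (auto simp: eq_meet_def)
next
  case (le_Meet_left2 s u t)
  then obtain A where "upper i s = Some A" "A \<subseteq> B" by blast
  then show ?case by (cases "upper i t") (auto simp: eq_meet_def)
next
  case (le_Join_right1 u t s)
  then obtain B1 B2 where B: "upper i t = Some B1" "upper i s = Some B2" "B = eq_join B1 B2"
    by (auto split: option.splits)
  then show ?case using le_Join_right1 by (meson eq_join_upper1 valid_term.simps(3))
next
  case (le_Join_right2 u s t)
  then obtain B1 B2 where B: "upper i t = Some B1" "upper i s = Some B2" "B = eq_join B1 B2"
    by (auto split: option.splits)
  then show ?case using le_Join_right2 by (meson eq_join_upper2 valid_term.simps(3))
qed

lemma le_lower:
  "le t s \<Longrightarrow> valid_term s \<Longrightarrow> lower i t = Some A \<Longrightarrow> \<exists>B. lower i s = Some B \<and> A \<subseteq> B"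
proof (induction arbitrary: A rule: le.induct)
  case (le_cover j t A s C)
  then show ?case using lower_upper by blast
next
  case (le_Meet_right u t s)
  then obtain A1 A2 where "lower i t = Some A1" "A \<subseteq> A1" "lower i s = Some A2" "A \<subseteq> A2"
    by fastforce
  then show ?case by (auto simp: eq_meet_def)
next
  case (le_Join_left t u s)
  show ?case
  proof (cases "lower i t")
    case None then show ?thesis using le_Join_left by auto
  next
    case (Some A1)
    then obtain B where B: "lower i u = Some B" "A1 \<subseteq> B" using le_Join_left by auto
    show ?thesis
    proof (cases "lower i s")
      case None then show ?thesis using B Some le_Join_left by auto
    next
      case (Some A2)
      then have "A2 \<subseteq> B" "A = eq_join A1 A2"
        using le_Join_left B(1) \<open>lower i t = Some A1\<close> by auto
      then show ?thesis
        using B lower_EqL[OF le_Join_left.prems(1) B(1)] eq_join_least[of B] by blast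
    qed
  qed
next
  case (le_Join_right1 u t s)
  then obtain B where "lower i t = Some B" "A \<subseteq> B" by auto
  then show ?case by (cases "lower i s") (auto simp: eq_join_upper1)
next
  case (le_Join_right2 u s t)
  then obtain B where "lower i s = Some B" "A \<subseteq> B" by auto
  then show ?case by (cases "lower i t") (auto simp: eq_join_upper2)
next
  case (le_Meet_left1 t u s)
  then obtain A1 A2 where B: "lower i t = Some A1" "lower i s = Some A2" "A = eq_meet A1 A2"
    by (auto split: option.splits)
  then show ?case using le_Meet_left1 by (fastforce simp: eq_meet_def)
next
  case (le_Meet_left2 s u t)
  then obtain A1 A2 where B: "lower i t = Some A1" "lower i s = Some A2" "A = eq_meet A1 A2"
    by (auto split: option.splits)
  then show ?case using le_Meet_left2 by (fastforce simp: eq_meet_def)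
qed

lemma le_refl: "le t t"
proof (induction t)
  case (Gen g)
  show ?case by (rule le_cover[of "isl g"]) auto
qed (auto intro: le.intros)

text \<open>Cut elimination: the outer induction shrinks the cut term \<open>s\<close>, inner
  inductions run over the two derivations. Covers pass through by \<open>le_upper\<close> and
  \<open>le_lower\<close>.\<close>

lemma le_trans:
  "le t s \<Longrightarrow> le s u \<Longrightarrow> valid_term s \<Longrightarrow> valid_term u \<Longrightarrow> le t u"
proof (induction s arbitrary: t u rule: measure_induct_rule[of size])
  case (less s)
  \<comment> \<open>The left derivation has just introduced \<open>Meet a b\<close>: follow the
    right one to the rule that takes it apart, where the cut shrinks to \<open>a\<close> or
    \<open>b\<close>. \<open>Join\<close> is dual.\<close>
  have Meet: "le t u'" if "le (Meet a b) u'" "le t a" "le t b" "s = Meet a b" "valid_term u'"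
    for a b t u'
  proof -
    have "le s' u' \<Longrightarrow> s' = Meet a b \<Longrightarrow> valid_term u' \<Longrightarrow> le t u'" for s' u'
    proof (induction rule: le.induct)
      case (le_cover i s' A u' B)
      then show ?case
        using le_upper[OF le_Meet_right[OF that(2,3)], of i A] that(4) less.prems(3)
        by (meson le.le_cover order_trans)
    next
      case (le_Meet_left1 x v y)
      then show ?case using less.IH[of a t v] that less.prems(3) by simp
    next
      case (le_Meet_left2 y v x)
      then show ?case using less.IH[of b t v] that less.prems(3) by simp
    qed (use le.intros in auto)
    then show ?thesis using that by blast
  qed
  have Join: "le t u'" if "le (Join a b) u'" "le t a \<or> le t b" "s = Join a b" "valid_term u'"
    for a b t u'
  proof -
    have "le s' u' \<Longrightarrow> s' = Join a b \<Longrightarrow> valid_term u' \<Longrightarrow> le t u'" for s' u'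
    proof (induction rule: le.induct)
      case (le_cover i s' A u' B)
      have "le t s'" using that(2) le_cover(4) le_Join_right1 le_Join_right2 by blast
      then show ?case
        using le_upper[of t s' i A] le_cover that(3) less.prems(3)
        by (meson le.le_cover order_trans)
    next
      case (le_Join_left x v y)
      then show ?case using less.IH[of a t v] less.IH[of b t v] that less.prems(3) by auto
    qed (use le.intros in auto)
    then show ?thesis using that by blast
  qed
  have "le t s' \<Longrightarrow> s' = s \<Longrightarrow> le s u \<Longrightarrow> le t u" for s'
  proof (induction rule: le.induct)
    case (le_cover i t A s' B)
    then show ?case
      using le_lower[of s u i B] less.prems(4) by (meson le.le_cover order_trans)
  next
    case (le_Join_left t1 s' t2) then show ?case by (simp add: le.le_Join_left)
  next
    case (le_Meet_left1 t1 s' t2) then show ?case by (simp add: le.le_Meet_left1)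
  next
    case (le_Meet_left2 t2 s' t1) then show ?case by (simp add: le.le_Meet_left2)
  next
    case (le_Meet_right t a b) then show ?case using Meet less.prems(4) by blast
  next
    case (le_Join_right1 t a b) then show ?case using Join less.prems(4) by blast
  next
    case (le_Join_right2 t b a) then show ?case using Join less.prems(4) by blast
  qed
  then show ?case using less.prems by blast
qed

lemma le_upper1: "le t (Join t s)" and le_upper2: "le s (Join t s)"
  and le_lower1: "le (Meet t s) t" and le_lower2: "le (Meet t s) s"
  by (auto intro: le.intros le_refl)

lemma le_Join_iff:
  assumes "valid_term t" "valid_term s" "valid_term u"
  shows "le (Join t s) u \<longleftrightarrow> le t u \<and> le s u"
  using assms le_trans[OF le_upper1, of t s u] le_trans[OF le_upper2, of t s u]
  by (auto intro: le_Join_left)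

lemma le_Meet_iff:
  assumes "valid_term t" "valid_term s"
  shows "le u (Meet t s) \<longleftrightarrow> le u t \<and> le u s"
  using assms le_trans[OF _ le_lower1, of u t s] le_trans[OF _ le_lower2, of u t s]
  by (auto intro: le_Meet_right)

section \<open>Soundness of the cut-free order\<close>

definition coprod_le :: "('a rel + 'a rel) lterm \<Rightarrow> ('a rel + 'a rel) lterm \<Rightarrow> bool" where
  "coprod_le t s \<longleftrightarrow> coprod_eq (Join t s) s"

lemma coprod_eq_imp_le: "coprod_eq t s \<Longrightarrow> coprod_le t s"
  unfolding coprod_le_def by (meson ce_join ce_join_idem ce_refl ce_trans)

lemma coprod_le_trans: "coprod_le t s \<Longrightarrow> coprod_le s u \<Longrightarrow> coprod_le t u"
  unfolding coprod_le_def
  by (meson ce_join ce_join_assoc ce_refl ce_sym ce_trans)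

lemma coprod_le_antisym: "coprod_le t s \<Longrightarrow> coprod_le s t \<Longrightarrow> coprod_eq t s"
  unfolding coprod_le_def by (meson ce_join_comm ce_sym ce_trans)

lemma coprod_le_upper1: "coprod_le t (Join t s)"
  unfolding coprod_le_def by (meson ce_join ce_join_assoc ce_join_idem ce_refl ce_sym ce_trans)

lemma coprod_le_upper2: "coprod_le s (Join t s)"
  using coprod_le_upper1 coprod_eq_imp_le[OF ce_join_comm] coprod_le_trans by blast

lemma coprod_le_least: "coprod_le t u \<Longrightarrow> coprod_le s u \<Longrightarrow> coprod_le (Join t s) u"
  unfolding coprod_le_def by (meson ce_join ce_join_assoc ce_refl ce_trans)

lemma coprod_le_iff_Meet: "coprod_le t s \<longleftrightarrow> coprod_eq (Meet t s) t"
proof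
  assume "coprod_le t s"
  then have "coprod_eq (Meet t s) (Meet t (Join t s))"
    unfolding coprod_le_def by (meson ce_meet ce_refl ce_sym)
  then show "coprod_eq (Meet t s) t" by (meson ce_absorb2 ce_trans)
next
  assume "coprod_eq (Meet t s) t"
  then have "coprod_eq (Join t s) (Join (Meet s t) s)"
    by (meson ce_join ce_meet_comm ce_refl ce_sym ce_trans)
  then show "coprod_le t s"
    unfolding coprod_le_def by (meson ce_absorb1 ce_join_comm ce_trans)
qed

lemma coprod_le_lower1: "coprod_le (Meet t s) t"
  unfolding coprod_le_def by (meson ce_absorb1 ce_join_comm ce_trans)

lemma coprod_le_lower2: "coprod_le (Meet t s) s"
  using coprod_le_lower1 coprod_eq_imp_le[OF ce_meet_comm] coprod_le_trans by blast

lemma coprod_le_greatest: "coprod_le u t \<Longrightarrow> coprod_le u s \<Longrightarrow> coprod_le u (Meet t s)"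
  unfolding coprod_le_iff_Meet by (meson ce_meet ce_meet_assoc ce_refl ce_sym ce_trans)

definition gen :: "bool \<Rightarrow> 'a rel \<Rightarrow> ('a rel + 'a rel) lterm" where
  "gen i A = Gen (if i then Inl A else Inr A)"

lemma gen_join: "A \<in> EqL \<Longrightarrow> B \<in> EqL \<Longrightarrow>
    coprod_eq (Join (gen i A) (gen i B)) (gen i (eq_join A B))"
  by (auto simp: gen_def ce_inl_join ce_inr_join)

lemma gen_meet: "A \<in> EqL \<Longrightarrow> B \<in> EqL \<Longrightarrow>
    coprod_eq (Meet (gen i A) (gen i B)) (gen i (eq_meet A B))"
  by (auto simp: gen_def ce_inl_meet ce_inr_meet)

lemma gen_mono:
  assumes "A \<in> EqL" "B \<in> EqL" "A \<subseteq> B"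
  shows "coprod_le (gen i A) (gen i B)"
  using gen_meet[OF assms(1,2), of i] assms(3)
  by (simp add: coprod_le_iff_Meet eq_meet_def inf_absorb1)

lemma coprod_le_upper:
  "valid_term t \<Longrightarrow> upper i t = Some A \<Longrightarrow> coprod_le t (gen i A)"
proof (induction t arbitrary: A)
  case (Gen g)
  then show ?case
    by (cases g) (auto simp: gen_def split: if_splits intro: coprod_eq_imp_le ce_refl)
next
  case (Join t s)
  then obtain B C where A: "upper i t = Some B" "upper i s = Some C" "A = eq_join B C"
    by (auto split: option.splits)
  then have "coprod_le t (Join (gen i B) (gen i C))" "coprod_le s (Join (gen i B) (gen i C))"
    using Join coprod_le_upper1 coprod_le_upper2 coprod_le_trans by (meson valid_term.simps(3))+
  then have "coprod_le (Join t s) (Join (gen i B) (gen i C))"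
    by (rule coprod_le_least)
  moreover have "coprod_le (Join (gen i B) (gen i C)) (gen i A)"
    using A Join.prems upper_EqL gen_join coprod_eq_imp_le by (metis valid_term.simps(3))
  ultimately show ?case by (rule coprod_le_trans)
next
  case (Meet t s)
  show ?case
  proof (cases "upper i t")
    case None
    then show ?thesis using Meet coprod_le_trans[OF coprod_le_lower2] by auto
  next
    case B: (Some B)
    show ?thesis
    proof (cases "upper i s")
      case None
      then show ?thesis using B Meet coprod_le_trans[OF coprod_le_lower1] by auto
    next
      case C: (Some C)
      have "coprod_le (Meet t s) (Meet (gen i B) (gen i C))"
        using Meet B C coprod_le_trans[OF coprod_le_lower1] coprod_le_trans[OF coprod_le_lower2]
        by (intro coprod_le_greatest) auto
      moreover have "coprod_le (Meet (gen i B) (gen i C)) (gen i (eq_meet B C))"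
        using B C Meet.prems upper_EqL gen_meet coprod_eq_imp_le by (metis valid_term.simps(4))
      ultimately show ?thesis using B C Meet.prems coprod_le_trans by auto
    qed
  qed
qed

lemma coprod_lower_le:
  "valid_term t \<Longrightarrow> lower i t = Some A \<Longrightarrow> coprod_le (gen i A) t"
proof (induction t arbitrary: A)
  case (Gen g)
  then show ?case
    by (cases g) (auto simp: gen_def split: if_splits intro: coprod_eq_imp_le ce_refl)
next
  case (Meet t s)
  then obtain B C where A: "lower i t = Some B" "lower i s = Some C" "A = eq_meet B C"
    by (auto split: option.splits)
  then have "coprod_le (Meet (gen i B) (gen i C)) t" "coprod_le (Meet (gen i B) (gen i C)) s"
    using Meet coprod_le_lower1 coprod_le_lower2 coprod_le_trans by (meson valid_term.simps(4))+
  then have "coprod_le (Meet (gen i B) (gen i C)) (Meet t s)"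
    by (rule coprod_le_greatest)
  moreover have "coprod_le (gen i A) (Meet (gen i B) (gen i C))"
    using A Meet.prems lower_EqL gen_meet coprod_eq_imp_le ce_sym by (metis valid_term.simps(4))
  ultimately show ?case using coprod_le_trans by blast
next
  case (Join t s)
  show ?case
  proof (cases "lower i t")
    case None
    then show ?thesis using Join coprod_le_trans[OF _ coprod_le_upper2] by auto
  next
    case B: (Some B)
    show ?thesis
    proof (cases "lower i s")
      case None
      then show ?thesis using B Join coprod_le_trans[OF _ coprod_le_upper1] by auto
    next
      case C: (Some C)
      have "coprod_le (Join (gen i B) (gen i C)) (Join t s)"
        using Join B C coprod_le_trans[OF _ coprod_le_upper1] coprod_le_trans[OF _ coprod_le_upper2]
        by (intro coprod_le_least) auto
      moreover have "coprod_le (gen i (eq_join B C)) (Join (gen i B) (gen i C))"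
        using B C Join.prems lower_EqL gen_join coprod_eq_imp_le ce_sym
        by (metis valid_term.simps(3))
      ultimately show ?thesis using B C Join.prems coprod_le_trans by auto
    qed
  qed
qed

text \<open>Only this direction is proved for \<open>le\<close> directly. The converse goes through
  \<open>below\<close>, because a derivation of \<open>coprod_eq\<close> may visit invalid terms,
  which \<open>le_trans\<close> does not cover.\<close>

lemma le_imp_coprod_le:
  "le t s \<Longrightarrow> valid_term t \<Longrightarrow> valid_term s \<Longrightarrow> coprod_le t s"
proof (induction rule: le.induct)
  case (le_cover i t A s B)
  then show ?case
    by (meson coprod_le_upper coprod_lower_le gen_mono upper_EqL lower_EqL coprod_le_trans)
next
  case (le_Join_left t u s) then show ?case by (simp add: coprod_le_least)
next
  case (le_Meet_right u t s) then show ?case by (simp add: coprod_le_greatest)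
next
  case (le_Meet_left1 t u s)
  then show ?case using coprod_le_trans[OF coprod_le_lower1] by simp
next
  case (le_Meet_left2 s u t)
  then show ?case using coprod_le_trans[OF coprod_le_lower2] by simp
next
  case (le_Join_right1 u t s)
  then show ?case using coprod_le_trans[OF _ coprod_le_upper1] by simp
next
  case (le_Join_right2 u s t)
  then show ?case using coprod_le_trans[OF _ coprod_le_upper2] by simp
qed

section \<open>Finite approximations\<close>

text \<open>Sending non-equivalences to \<open>Id\<close> makes \<open>approx \<Phi> t\<close> valid for every term, which matters
  because \<open>coprod_eq\<close> may pass through invalid terms.\<close>

definition trunc :: "'a set \<Rightarrow> 'a rel \<Rightarrow> 'a rel" where
  "trunc \<Phi> R = (if R \<in> EqL then Id \<union> (R \<inter> \<Phi> \<times> \<Phi>) else Id)"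

definition approx :: "'a set \<Rightarrow> ('a rel + 'a rel) lterm \<Rightarrow> ('a rel + 'a rel) lterm" where
  "approx \<Phi> = map_lterm (map_sum (trunc \<Phi>) (trunc \<Phi>))"

lemma approx_simps [simp]:
  "approx \<Phi> (Gen g) = Gen (map_sum (trunc \<Phi>) (trunc \<Phi>) g)"
  "approx \<Phi> (Join t s) = Join (approx \<Phi> t) (approx \<Phi> s)"
  "approx \<Phi> (Meet t s) = Meet (approx \<Phi> t) (approx \<Phi> s)"
  by (auto simp: approx_def)

lemma EqL_D: "R \<in> EqL \<Longrightarrow> Id \<subseteq> R" "R \<in> EqL \<Longrightarrow> (x, y) \<in> R \<Longrightarrow> (y, x) \<in> R"
  "R \<in> EqL \<Longrightarrow> (x, y) \<in> R \<Longrightarrow> (y, z) \<in> R \<Longrightarrow> (x, z) \<in> R"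
  unfolding EqL_def equiv_def by (auto dest: refl_onD symD transD)

lemma Id_EqL: "Id \<in> EqL" and UNIV_EqL: "UNIV \<in> EqL"
  by (auto simp: EqL_def equiv_def refl_on_def sym_def trans_def)

lemma trunc_EqL: "trunc \<Phi> R \<in> EqL"
proof (cases "R \<in> EqL")
  case True
  have "refl (trunc \<Phi> R)"
    by (auto simp: trunc_def refl_on_def)
  moreover have "sym (trunc \<Phi> R)"
    by (rule symI) (use True EqL_D(2)[OF True] in \<open>unfold trunc_def, auto\<close>)
  moreover have "trans (trunc \<Phi> R)"
    by (rule transI) (unfold trunc_def, use True in \<open>auto dest: EqL_D(3)\<close>)
  ultimately show ?thesis by (auto simp: EqL_def equiv_def)
qed (simp add: trunc_def Id_EqL)

lemma trunc_mono: "\<Phi> \<subseteq> \<Psi> \<Longrightarrow> trunc \<Phi> R \<subseteq> trunc \<Psi> R"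
  by (auto simp: trunc_def)

lemma trunc_subset: "R \<in> EqL \<Longrightarrow> trunc \<Phi> R \<subseteq> R"
  using EqL_D(1) by (auto simp: trunc_def)

lemma valid_approx [simp]: "valid_term (approx \<Phi> t)"
  by (induction t) (auto simp: trunc_EqL)

lemma le_Gen: "isl g = isl h \<Longrightarrow> carrier_rel g \<subseteq> carrier_rel h \<Longrightarrow> le (Gen g) (Gen h)"
  by (rule le_cover[of "isl g"]) auto

lemma le_Join_mono: "le t t' \<Longrightarrow> le s s' \<Longrightarrow> le (Join t s) (Join t' s')"
  by (auto intro: le.intros)

lemma le_Meet_mono: "le t t' \<Longrightarrow> le s s' \<Longrightarrow> le (Meet t s) (Meet t' s')"
  by (auto intro: le.intros)

lemma approx_mono: "\<Phi> \<subseteq> \<Psi> \<Longrightarrow> le (approx \<Phi> t) (approx \<Psi> t)"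
  by (induction t) (simp_all add: le_Gen le_Join_mono le_Meet_mono trunc_mono)

lemma approx_le: "valid_term t \<Longrightarrow> le (approx \<Phi> t) t"
  by (induction t) (simp_all add: le_Gen le_Join_mono le_Meet_mono trunc_subset)

section \<open>Continuity of upper covers\<close>

lemma upper_approx_mono:
  assumes "\<Phi> \<subseteq> \<Psi>" "upper i (approx \<Psi> t) = Some B"
  shows "\<exists>A. upper i (approx \<Phi> t) = Some A \<and> A \<subseteq> B"
  using le_upper[OF approx_mono[OF assms(1)] valid_approx assms(2)] .

text \<open>A chain witnessing membership in a join has finitely many links; by monotonicity the
  union of the finite sets that capture the links captures the chain.\<close>

lemma eq_join_approx:
  assumes "(x, y) \<in> eq_join A B"
    and "\<And>p. p \<in> A \<Longrightarrow> \<exists>\<Phi>. finite \<Phi> \<and> p \<in> F \<Phi>"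
    and "\<And>p. p \<in> B \<Longrightarrow> \<exists>\<Phi>. finite \<Phi> \<and> p \<in> G \<Phi>"
    and mono: "\<And>\<Phi> \<Psi>. \<Phi> \<subseteq> \<Psi> \<Longrightarrow> F \<Phi> \<subseteq> F \<Psi>" "\<And>\<Phi> \<Psi>. \<Phi> \<subseteq> \<Psi> \<Longrightarrow> G \<Phi> \<subseteq> G \<Psi>"
  shows "\<exists>\<Phi>. finite \<Phi> \<and> (x, y) \<in> eq_join (F \<Phi>) (G \<Phi>)"
  using assms(1) unfolding eq_join_def
proof (induction rule: trancl_induct)
  case (base y)
  then show ?case using assms(2,3) by blast
next
  case (step y z)
  obtain \<Phi> where \<Phi>: "finite \<Phi>" "(y, z) \<in> F \<Phi> \<union> G \<Phi>"
    using step(2) assms(2,3) by blast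
  obtain \<Psi> where \<Psi>: "finite \<Psi>" "(x, y) \<in> (F \<Psi> \<union> G \<Psi>)\<^sup>+"
    using step.IH by blast
  have "(x, y) \<in> (F (\<Phi> \<union> \<Psi>) \<union> G (\<Phi> \<union> \<Psi>))\<^sup>+"
    using \<Psi>(2) mono[of \<Psi> "\<Phi> \<union> \<Psi>"]
    by (meson Un_mono Un_upper2 subsetD trancl_mono_subset)
  moreover have "(y, z) \<in> F (\<Phi> \<union> \<Psi>) \<union> G (\<Phi> \<union> \<Psi>)"
    using \<Phi>(2) mono[of \<Phi> "\<Phi> \<union> \<Psi>"] by blast
  ultimately show ?case
    using \<Phi>(1) \<Psi>(1) by (intro exI[of _ "\<Phi> \<union> \<Psi>"]) (auto intro: trancl_into_trancl)
qed

text \<open>Whether a cover exists depends only on the shape of the term and the sides of its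
  generators, which truncation keeps.\<close>

lemma upper_approx_None: "upper i t = None \<Longrightarrow> upper i (approx \<Phi> t) = None"
  by (induction t) (auto split: option.splits if_splits)

lemma upper_approx_Some: "upper i t = Some A \<Longrightarrow> \<exists>B. upper i (approx \<Phi> t) = Some B"
proof (induction t arbitrary: A)
  case (Join t s)
  then show ?case by (cases "upper i t"; cases "upper i s") fastforce+
next
  case (Meet t s)
  then show ?case by (cases "upper i t"; cases "upper i s") (fastforce split: option.splits)+
qed (auto split: if_splits)

text \<open>A pair in a generator survives truncation to its two entries. Joins are handled by
  \<open>eq_join_approx\<close>, intersections by uniting two finite witnesses.\<close>

lemma upper_approx:
  "valid_term t \<Longrightarrow> upper i t = Some A \<Longrightarrow> p \<in> A \<Longrightarrow>
    \<exists>\<Phi>. finite \<Phi> \<and> (\<exists>B. upper i (approx \<Phi> t) = Some B \<and> p \<in> B)"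
proof (induction t arbitrary: A p)
  case (Gen g)
  then show ?case
    by (intro exI[of _ "{fst p, snd p}"]) (auto simp: trunc_def split: if_splits)
next
  case (Join t s)
  then obtain A1 A2 where A: "upper i t = Some A1" "upper i s = Some A2" "A = eq_join A1 A2"
    by (auto split: option.splits)
  let ?F = "\<lambda>\<Phi>. the (upper i (approx \<Phi> t))" and ?G = "\<lambda>\<Phi>. the (upper i (approx \<Phi> s))"
  have def: "\<exists>B. upper i (approx \<Phi> t) = Some B" "\<exists>B. upper i (approx \<Phi> s) = Some B" for \<Phi>
    using A upper_approx_Some by blast+
  obtain x y where p: "p = (x, y)" by (cases p)
  have "\<exists>\<Phi>. finite \<Phi> \<and> (x, y) \<in> eq_join (?F \<Phi>) (?G \<Phi>)"
  proof (rule eq_join_approx[of x y A1 A2])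
    show "(x, y) \<in> eq_join A1 A2" using A Join.prems p by simp
    show "\<exists>\<Phi>. finite \<Phi> \<and> p \<in> ?F \<Phi>" if "p \<in> A1" for p
      using Join.IH(1)[OF _ A(1) that] Join.prems by force
    show "\<exists>\<Phi>. finite \<Phi> \<and> p \<in> ?G \<Phi>" if "p \<in> A2" for p
      using Join.IH(2)[OF _ A(2) that] Join.prems by force
    show "?F \<Phi> \<subseteq> ?F \<Psi>" "?G \<Phi> \<subseteq> ?G \<Psi>" if "\<Phi> \<subseteq> \<Psi>" for \<Phi> \<Psi>
      using def[of \<Psi>] upper_approx_mono[OF that] by fastforce+
  qed
  then obtain \<Phi> where "finite \<Phi>" "p \<in> eq_join (?F \<Phi>) (?G \<Phi>)" using p by blast
  then show ?case using def[of \<Phi>] by (intro exI[of _ \<Phi>]) auto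
next
  case (Meet t s)
  show ?case
  proof (cases "upper i t")
    case None
    then show ?thesis using upper_approx_None[OF None] Meet by simp
  next
    case A1: (Some A1)
    then have "p \<in> A1"
      using Meet.prems by (auto simp: eq_meet_def split: option.splits)
    then have 1: "\<exists>\<Phi> B. finite \<Phi> \<and> upper i (approx \<Phi> t) = Some B \<and> p \<in> B"
      using Meet.IH(1)[OF _ A1] Meet.prems(1) by auto
    show ?thesis
    proof (cases "upper i s")
      case None
      then show ?thesis using upper_approx_None[OF None] 1 by auto
    next
      case A2: (Some A2)
      then have "p \<in> A2"
        using A1 Meet.prems by (auto simp: eq_meet_def)
      then have "\<exists>\<Phi> B. finite \<Phi> \<and> upper i (approx \<Phi> s) = Some B \<and> p \<in> B"
        using Meet.IH(2)[OF _ A2] Meet.prems(1) by auto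
      with 1 obtain \<Phi> \<Psi> B C where *: "finite \<Phi>" "upper i (approx \<Phi> t) = Some B" "p \<in> B"
        "finite \<Psi>" "upper i (approx \<Psi> s) = Some C" "p \<in> C"
        by blast
      obtain B' C' where "upper i (approx (\<Phi> \<union> \<Psi>) t) = Some B'" "upper i (approx (\<Phi> \<union> \<Psi>) s) = Some C'"
        using upper_approx_Some[OF A1] upper_approx_Some[OF A2] by blast
      moreover from this have "p \<in> B'" "p \<in> C'"
        using * upper_approx_mono[of \<Phi> "\<Phi> \<union> \<Psi>" i t B'] upper_approx_mono[of \<Psi> "\<Phi> \<union> \<Psi>" i s C']
        by auto
      ultimately show ?thesis
        using * by (intro exI[of _ "\<Phi> \<union> \<Psi>"]) (auto simp: eq_meet_def)
    qed
  qed
qed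

text \<open>The rules for a join on the left and a meet on the right are invertible, by
  \<open>le_Join_iff\<close> and \<open>le_Meet_iff\<close>. Where neither applies, these are the
  remaining last rules.\<close>

lemma le_cases_irreducible:
  assumes "le t s" "\<nexists>t1 t2. t = Join t1 t2" "\<nexists>s1 s2. s = Meet s1 s2"
  obtains (cover) i A B where "upper i t = Some A" "lower i s = Some B" "A \<subseteq> B"
  | (left) t1 t2 where "t = Meet t1 t2" "le t1 s \<or> le t2 s"
  | (right) s1 s2 where "s = Join s1 s2" "le t s1 \<or> le t s2"
  using assms by (cases rule: le.cases) auto

text \<open>The upper covers of \<open>t\<close> are unions of those of its approximations, so each way in which
  \<open>le t s\<close> can fail is witnessed by a finite set; the union of these sets makes all of them fail.\<close>

lemma not_le_approx:
  "valid_term t \<Longrightarrow> valid_term s \<Longrightarrow> \<not> le t s \<Longrightarrow> \<exists>\<Phi>. finite \<Phi> \<and> \<not> le (approx \<Phi> t) s"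
proof (induction "size t + size s" arbitrary: t s rule: less_induct)
  case less
  show ?case
  proof (cases "(\<exists>t1 t2. t = Join t1 t2) \<or> (\<exists>s1 s2. s = Meet s1 s2)")
    case True
    then show ?thesis
    proof (elim disjE exE)
      fix t1 t2 assume t: "t = Join t1 t2"
      then have "\<not> le t1 s \<or> \<not> le t2 s"
        using less.prems le_Join_left by blast
      then obtain \<Phi> where "finite \<Phi>" "\<not> le (approx \<Phi> t1) s \<or> \<not> le (approx \<Phi> t2) s"
        using less.hyps[of t1 s] less.hyps[of t2 s] less.prems t by auto
      then show ?thesis
        using t less.prems by (auto simp: le_Join_iff)
    next
      fix s1 s2 assume s: "s = Meet s1 s2"
      then have "\<not> le t s1 \<or> \<not> le t s2"
        using less.prems le_Meet_right by blast
      then obtain \<Phi> where "finite \<Phi>" "\<not> le (approx \<Phi> t) s1 \<or> \<not> le (approx \<Phi> t) s2"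
        using less.hyps[of t s1] less.hyps[of t s2] less.prems s by auto
      then show ?thesis
        using s less.prems by (auto simp: le_Meet_iff)
    qed
  next
    case False
    \<comment> \<open>The claims are made for every larger \<open>\<Psi>\<close>, so that they
      survive when the witnesses for both factors, for \<open>left\<close> and for
      \<open>right\<close> are united.\<close>
    have cover: "\<exists>\<Phi>. finite \<Phi> \<and> (\<forall>\<Psi> A B. \<Phi> \<subseteq> \<Psi> \<longrightarrow> upper i (approx \<Psi> t) = Some A \<longrightarrow>
        lower i s = Some B \<longrightarrow> \<not> A \<subseteq> B)" for i
    proof (cases "upper i t = None \<or> lower i s = None")
      case True
      then show ?thesis using upper_approx_None[of i t] by auto
    next
      case False
      then obtain A B where AB: "upper i t = Some A" "lower i s = Some B" by auto
      then have "\<not> A \<subseteq> B" using less.prems le_cover by blast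
      then obtain p where p: "p \<in> A" "p \<notin> B" by blast
      then obtain \<Phi> C where \<Phi>: "finite \<Phi>" "upper i (approx \<Phi> t) = Some C" "p \<in> C"
        using upper_approx[OF less.prems(1) AB(1)] by blast
      have "p \<in> A'" if "\<Phi> \<subseteq> \<Psi>" "upper i (approx \<Psi> t) = Some A'" for \<Psi> A'
        using upper_approx_mono[OF that] \<Phi> by auto
      then have "\<not> A' \<subseteq> B" if "\<Phi> \<subseteq> \<Psi>" "upper i (approx \<Psi> t) = Some A'" for \<Psi> A'
        using that p(2) by blast
      then show ?thesis using \<Phi>(1) AB(2) by (intro exI[of _ \<Phi>]) simp
    qed
    have mono: "\<not> le (approx \<Psi> u) v" if "\<not> le (approx \<Phi> u) v" "\<Phi> \<subseteq> \<Psi>" "valid_term v" for \<Phi> \<Psi> u v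
      using that(1) le_trans[OF approx_mono[OF that(2)] _ valid_approx that(3)] by blast
    have left: "\<exists>\<Phi>. finite \<Phi> \<and> (\<forall>\<Psi> t1 t2. \<Phi> \<subseteq> \<Psi> \<longrightarrow> t = Meet t1 t2 \<longrightarrow>
        \<not> le (approx \<Psi> t1) s \<and> \<not> le (approx \<Psi> t2) s)"
    proof (cases "\<exists>t1 t2. t = Meet t1 t2")
      case True
      then obtain t1 t2 where t: "t = Meet t1 t2" by blast
      then have "\<not> le t1 s" "\<not> le t2 s"
        using less.prems(3) le_Meet_left1 le_Meet_left2 by blast+
      then obtain \<Phi>1 \<Phi>2 where "finite \<Phi>1" "\<not> le (approx \<Phi>1 t1) s"
        "finite \<Phi>2" "\<not> le (approx \<Phi>2 t2) s"
        using less.hyps[of t1 s] less.hyps[of t2 s] less.prems t by auto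
      then show ?thesis
        using mono[of \<Phi>1 t1 s] mono[of \<Phi>2 t2 s] t less.prems(2)
        by (intro exI[of _ "\<Phi>1 \<union> \<Phi>2"]) simp
    qed auto
    have right: "\<exists>\<Phi>. finite \<Phi> \<and> (\<forall>\<Psi> s1 s2. \<Phi> \<subseteq> \<Psi> \<longrightarrow> s = Join s1 s2 \<longrightarrow>
        \<not> le (approx \<Psi> t) s1 \<and> \<not> le (approx \<Psi> t) s2)"
    proof (cases "\<exists>s1 s2. s = Join s1 s2")
      case True
      then obtain s1 s2 where s: "s = Join s1 s2" by blast
      then have "\<not> le t s1" "\<not> le t s2"
        using less.prems(3) le_Join_right1 le_Join_right2 by blast+
      then obtain \<Phi>1 \<Phi>2 where "finite \<Phi>1" "\<not> le (approx \<Phi>1 t) s1"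
        "finite \<Phi>2" "\<not> le (approx \<Phi>2 t) s2"
        using less.hyps[of t s1] less.hyps[of t s2] less.prems s by auto
      then show ?thesis
        using mono[of \<Phi>1 t s1] mono[of \<Phi>2 t s2] s less.prems(2)
        by (intro exI[of _ "\<Phi>1 \<union> \<Phi>2"]) simp
    qed auto
    obtain \<Phi>1 where 1: "finite \<Phi>1" "\<And>\<Psi> A B. \<Phi>1 \<subseteq> \<Psi> \<Longrightarrow>
        upper True (approx \<Psi> t) = Some A \<Longrightarrow> lower True s = Some B \<Longrightarrow> \<not> A \<subseteq> B"
      using cover[of True] by blast
    obtain \<Phi>2 where 2: "finite \<Phi>2" "\<And>\<Psi> A B. \<Phi>2 \<subseteq> \<Psi> \<Longrightarrow>
        upper False (approx \<Psi> t) = Some A \<Longrightarrow> lower False s = Some B \<Longrightarrow> \<not> A \<subseteq> B"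
      using cover[of False] by blast
    obtain \<Phi>3 where 3: "finite \<Phi>3" "\<And>\<Psi> t1 t2. \<Phi>3 \<subseteq> \<Psi> \<Longrightarrow> t = Meet t1 t2 \<Longrightarrow>
        \<not> le (approx \<Psi> t1) s \<and> \<not> le (approx \<Psi> t2) s"
      using left by blast
    obtain \<Phi>4 where 4: "finite \<Phi>4" "\<And>\<Psi> s1 s2. \<Phi>4 \<subseteq> \<Psi> \<Longrightarrow> s = Join s1 s2 \<Longrightarrow>
        \<not> le (approx \<Psi> t) s1 \<and> \<not> le (approx \<Psi> t) s2"
      using right by blast
    let ?\<Psi> = "\<Phi>1 \<union> \<Phi>2 \<union> \<Phi>3 \<union> \<Phi>4"
    have sub: "\<Phi>1 \<subseteq> ?\<Psi>" "\<Phi>2 \<subseteq> ?\<Psi>" "\<Phi>3 \<subseteq> ?\<Psi>" "\<Phi>4 \<subseteq> ?\<Psi>" by auto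
    have "\<not> le (approx ?\<Psi> t) s"
    proof
      assume "le (approx ?\<Psi> t) s"
      moreover have "\<nexists>t1 t2. approx ?\<Psi> t = Join t1 t2" "\<nexists>s1 s2. s = Meet s1 s2"
        using False by (cases t; auto)+
      ultimately show False
      proof (cases rule: le_cases_irreducible)
        case (cover i A B)
        then show ?thesis using 1(2)[OF sub(1)] 2(2)[OF sub(2)] by (cases i) auto
      next
        case (left u1 u2)
        then obtain t1 t2 where "t = Meet t1 t2" "u1 = approx ?\<Psi> t1" "u2 = approx ?\<Psi> t2"
          by (cases t) auto
        then show ?thesis using left 3(2)[OF sub(3)] by auto
      next
        case (right s1 s2)
        then show ?thesis using 4(2)[OF sub(4)] by auto
      qed
    qed
    then show ?thesis using 1(1) 2(1) 3(1) 4(1) by (intro exI[of _ ?\<Psi>]) auto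
  qed
qed

section \<open>Equivalence relations from ideals of labels\<close>

text \<open>\<open>E1 e a b, \<dots>, E4 e a b\<close> are the four edges of the path labelled \<open>a, b, a, b\<close> that is glued onto
  the edge \<open>e\<close>, and \<open>Z1 e a b, Z2 e a b, Z3 e a b\<close> are its inner vertices.\<close>

datatype 'm edge = Base 'm
  | E1 "'m edge" 'm 'm | E2 "'m edge" 'm 'm | E3 "'m edge" 'm 'm | E4 "'m edge" 'm 'm

datatype 'm vertex = Root | Leaf 'm
  | Z1 "'m edge" 'm 'm | Z2 "'m edge" 'm 'm | Z3 "'m edge" 'm 'm

primrec src :: "'m edge \<Rightarrow> 'm vertex" where
  "src (Base m) = Root"
| "src (E1 e a b) = src e"
| "src (E2 e a b) = Z1 e a b"
| "src (E3 e a b) = Z2 e a b"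
| "src (E4 e a b) = Z3 e a b"

primrec tgt :: "'m edge \<Rightarrow> 'm vertex" where
  "tgt (Base m) = Leaf m"
| "tgt (E1 e a b) = Z1 e a b"
| "tgt (E2 e a b) = Z2 e a b"
| "tgt (E3 e a b) = Z3 e a b"
| "tgt (E4 e a b) = tgt e"

primrec cost :: "'m edge \<Rightarrow> 'm" where
  "cost (Base m) = m"
| "cost (E1 e a b) = a"
| "cost (E2 e a b) = b"
| "cost (E3 e a b) = a"
| "cost (E4 e a b) = b"

primrec edge_depth :: "'m edge \<Rightarrow> nat" where
  "edge_depth (Base m) = 1"
| "edge_depth (E1 e a b) = Suc (edge_depth e)"
| "edge_depth (E2 e a b) = Suc (edge_depth e)"
| "edge_depth (E3 e a b) = Suc (edge_depth e)"
| "edge_depth (E4 e a b) = Suc (edge_depth e)"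

primrec depth :: "'m vertex \<Rightarrow> nat" where
  "depth Root = 0"
| "depth (Leaf m) = 1"
| "depth (Z1 e a b) = Suc (edge_depth e)"
| "depth (Z2 e a b) = Suc (edge_depth e)"
| "depth (Z3 e a b) = Suc (edge_depth e)"

lemma depth_src: "depth (src e) \<le> edge_depth e"
  by (induction e) auto

lemma depth_tgt: "depth (tgt e) \<le> edge_depth e"
  by (induction e) auto

text \<open>\<open>rep I\<close> picks a representative of least depth from each class of vertices connected by edges
  with labels in \<open>I\<close>.\<close>

function rep :: "'m set \<Rightarrow> 'm vertex \<Rightarrow> 'm vertex" where
  "rep I Root = Root"
| "rep I (Leaf m) = (if m \<in> I then Root else Leaf m)"
| "rep I (Z1 e a b) = (if a \<in> I then rep I (src e) else Z1 e a b)"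
| "rep I (Z2 e a b) =
     (if a \<in> I then (if b \<in> I then rep I (src e) else Z3 e a b)
      else (if b \<in> I then Z1 e a b else Z2 e a b))"
| "rep I (Z3 e a b) = (if b \<in> I then rep I (tgt e) else Z3 e a b)"
  by pat_completeness auto
termination
  by (relation "measure (depth \<circ> snd)") (auto simp: depth_src depth_tgt less_Suc_eq_le)

lemma depth_rep: "depth (rep I v) \<le> depth v"
proof (induction I v rule: rep.induct)
  case (3 I e a b) then show ?case using depth_src[of e] by fastforce
next
  case (4 I e a b) then show ?case using depth_src[of e] by fastforce
next
  case (5 I e a b) then show ?case using depth_tgt[of e] by fastforce
qed auto

lemma depth_rep_src: "depth (rep I (src e)) < Suc (edge_depth e)"
  using depth_rep[of I "src e"] depth_src[of e] by simp

lemma depth_rep_tgt: "depth (rep I (tgt e)) < Suc (edge_depth e)"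
  using depth_rep[of I "tgt e"] depth_tgt[of e] by simp

text \<open>Ideals are subsets of the whole type, whereas only members of \<open>M\<close> label
  edges. This allows a set of labels of the right cardinality that leaves out the bottom.\<close>

locale join_labels =
  fixes le :: "'m \<Rightarrow> 'm \<Rightarrow> bool" and jn :: "'m \<Rightarrow> 'm \<Rightarrow> 'm" and M :: "'m set"
begin

definition ideal :: "'m set \<Rightarrow> bool" where
  "ideal I \<longleftrightarrow> (\<forall>x y. y \<in> I \<longrightarrow> le x y \<longrightarrow> x \<in> I) \<and> (\<forall>x\<in>I. \<forall>y\<in>I. jn x y \<in> I)"

primrec wfe :: "'m edge \<Rightarrow> bool" where
  "wfe (Base m) \<longleftrightarrow> m \<in> M"
| "wfe (E1 e a b) \<longleftrightarrow> wfe e \<and> a \<in> M \<and> b \<in> M \<and> le (cost e) (jn a b)"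
| "wfe (E2 e a b) \<longleftrightarrow> wfe e \<and> a \<in> M \<and> b \<in> M \<and> le (cost e) (jn a b)"
| "wfe (E3 e a b) \<longleftrightarrow> wfe e \<and> a \<in> M \<and> b \<in> M \<and> le (cost e) (jn a b)"
| "wfe (E4 e a b) \<longleftrightarrow> wfe e \<and> a \<in> M \<and> b \<in> M \<and> le (cost e) (jn a b)"

primrec wfv :: "'m vertex \<Rightarrow> bool" where
  "wfv Root \<longleftrightarrow> True"
| "wfv (Leaf m) \<longleftrightarrow> m \<in> M"
| "wfv (Z1 e a b) \<longleftrightarrow> wfe e \<and> a \<in> M \<and> b \<in> M \<and> le (cost e) (jn a b)"
| "wfv (Z2 e a b) \<longleftrightarrow> wfe e \<and> a \<in> M \<and> b \<in> M \<and> le (cost e) (jn a b)"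
| "wfv (Z3 e a b) \<longleftrightarrow> wfe e \<and> a \<in> M \<and> b \<in> M \<and> le (cost e) (jn a b)"

text \<open>For an ideal, connectedness is encoded as equality of normal forms, which can be
  analysed by cases when treating meets. \<open>rep_connected\<close> provides the link to
  paths.\<close>

definition theta :: "'m set \<Rightarrow> 'm vertex rel" where
  "theta I = {(v, w). wfv v \<and> wfv w \<and> rep I v = rep I w}"

lemma wfv_ends: "wfe e \<Longrightarrow> wfv (src e) \<and> wfv (tgt e)"
  by (induction e) auto

lemma cost_in: "wfe e \<Longrightarrow> cost e \<in> M"
  by (induction e) auto

lemma ideal_cost: "ideal I \<Longrightarrow> le c (jn a b) \<Longrightarrow> a \<in> I \<Longrightarrow> b \<in> I \<Longrightarrow> c \<in> I"
  unfolding ideal_def by blast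

text \<open>The case with content is \<open>E3\<close> with both \<open>a\<close> and
  \<open>b\<close> in \<open>I\<close>: \<open>Z2\<close> goes to the class of \<open>src e\<close>
  and \<open>Z3\<close> to that of \<open>tgt e\<close>. Then \<open>cost e\<close> is in
  \<open>I\<close> by the gluing condition, and the induction hypothesis applies to
  \<open>e\<close>.\<close>

lemma rep_edge: "ideal I \<Longrightarrow> wfe e \<Longrightarrow> cost e \<in> I \<Longrightarrow> rep I (src e) = rep I (tgt e)"
  by (induction e) (auto dest: ideal_cost)

lemma theta_edge: "ideal I \<Longrightarrow> wfe e \<Longrightarrow> cost e \<in> I \<Longrightarrow> (src e, tgt e) \<in> theta I"
  using rep_edge wfv_ends unfolding theta_def by auto

text \<open>The critical vertex is \<open>Z2\<close> with \<open>a\<close> but not \<open>b\<close>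
  in \<open>I\<close> and both in \<open>K\<close>: through \<open>Z3\<close> it ends at the class
  of \<open>tgt e\<close>, directly at that of \<open>src e\<close>. \<open>rep_edge\<close>
  identifies the two.\<close>

lemma rep_rep: "ideal K \<Longrightarrow> I \<subseteq> K \<Longrightarrow> wfv v \<Longrightarrow> rep K (rep I v) = rep K v"
proof (induction I v rule: rep.induct)
  case (4 I e a b)
  moreover have "a \<in> K \<Longrightarrow> b \<in> K \<Longrightarrow> rep K (src e) = rep K (tgt e)"
    using 4 rep_edge ideal_cost by auto
  ultimately show ?case using wfv_ends by auto
qed (use wfv_ends in auto)

lemma theta_mono: "ideal K \<Longrightarrow> I \<subseteq> K \<Longrightarrow> theta I \<subseteq> theta K"
  unfolding theta_def using rep_rep[of K I] by (auto dest: arg_cong[of _ _ "rep K"])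

lemma equiv_theta: "equiv (Collect wfv) (theta I)"
  unfolding theta_def by (auto simp: equiv_def refl_on_def sym_def trans_def)

lemma rep_idem: "wfv v \<Longrightarrow> ideal I \<Longrightarrow> rep I (rep I v) = rep I v"
  using rep_rep by blast

section \<open>Normal forms and meets of ideals\<close>

lemma edge_depth_pos: "0 < edge_depth e"
  by (induction e) auto

lemma rep_src_neq: "edge_depth e \<le> edge_depth f \<Longrightarrow>
    rep I (src e) \<noteq> Z1 f a b \<and> rep I (src e) \<noteq> Z2 f a b \<and> rep I (src e) \<noteq> Z3 f a b"
  using depth_rep_src[of I e] by auto

lemma rep_tgt_neq: "edge_depth e \<le> edge_depth f \<Longrightarrow>
    rep I (tgt e) \<noteq> Z1 f a b \<and> rep I (tgt e) \<noteq> Z2 f a b \<and> rep I (tgt e) \<noteq> Z3 f a b"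
  using depth_rep_tgt[of I e] by auto

text \<open>The depth bound keeps out later subdivisions. From the other vertices within it, a
  normal form stays on its own subdivided edge or drops to the class of an end of that edge, which
  is too shallow.\<close>

lemma rep_eq_Z1:
  "rep I w = Z1 e a b \<Longrightarrow> depth w \<le> Suc (edge_depth e) \<Longrightarrow>
     w = Z1 e a b \<and> a \<notin> I \<or> w = Z2 e a b \<and> a \<notin> I \<and> b \<in> I"
  by (cases w) (auto simp: rep_src_neq rep_tgt_neq split: if_splits)

lemma rep_eq_Z2:
  "rep I w = Z2 e a b \<Longrightarrow> depth w \<le> Suc (edge_depth e) \<Longrightarrow> w = Z2 e a b"
  by (cases w) (auto simp: rep_src_neq rep_tgt_neq split: if_splits)

lemma rep_eq_Z3:
  "rep I w = Z3 e a b \<Longrightarrow> depth w \<le> Suc (edge_depth e) \<Longrightarrow>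
     w = Z3 e a b \<and> b \<notin> I \<or> w = Z2 e a b \<and> a \<in> I \<and> b \<notin> I"
  by (cases w) (auto simp: rep_src_neq rep_tgt_neq split: if_splits)

text \<open>One of the ideals, \<open>K\<close>, misses \<open>a\<close>, so the only rival is
  \<open>w = Z2\<close> with \<open>b\<close> in \<open>K\<close>. As \<open>w\<close> is normal for
  the intersection, \<open>b\<close> is not in the other ideal \<open>L\<close>; but then
  \<open>L\<close> sends \<open>Z2\<close> to \<open>Z3\<close> or fixes it, and so separates it
  from \<open>Z1\<close>.\<close>

lemma rep_inter_Z1:
  assumes "rep (I \<inter> J) (Z1 e a b) = Z1 e a b" "rep (I \<inter> J) w = w"
    and "depth w \<le> Suc (edge_depth e)"
    and "rep I (Z1 e a b) = rep I w" "rep J (Z1 e a b) = rep J w"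
  shows "w = Z1 e a b"
proof -
  have *: "w = Z1 e a b" if "a \<notin> K" "rep K (Z1 e a b) = rep K w" "rep L (Z1 e a b) = rep L w"
    "rep (K \<inter> L) w = w" for K L
  proof (rule ccontr)
    assume "w \<noteq> Z1 e a b"
    then have w: "w = Z2 e a b" "b \<in> K"
      using rep_eq_Z1[of K w e a b] that assms(3) by auto
    then show False
      using that rep_src_neq[of e e] by (auto split: if_splits)
  qed
  have "a \<notin> I \<or> a \<notin> J"
    using assms(1) rep_src_neq[of e e "I \<inter> J" a b] by auto
  then show ?thesis
    using *[of I J] *[of J I] assms by (metis Int_commute)
qed

lemma rep_inter_Z3:
  assumes "rep (I \<inter> J) (Z3 e a b) = Z3 e a b" "rep (I \<inter> J) w = w"
    and "depth w \<le> Suc (edge_depth e)"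
    and "rep I (Z3 e a b) = rep I w" "rep J (Z3 e a b) = rep J w"
  shows "w = Z3 e a b"
proof -
  have *: "w = Z3 e a b" if "b \<notin> K" "rep K (Z3 e a b) = rep K w" "rep L (Z3 e a b) = rep L w"
    "rep (K \<inter> L) w = w" for K L
  proof (rule ccontr)
    assume "w \<noteq> Z3 e a b"
    then have w: "w = Z2 e a b" "a \<in> K"
      using rep_eq_Z3[of K w e a b] that assms(3) by auto
    then show False
      using that rep_tgt_neq[of e e] rep_src_neq[of e e] by (auto split: if_splits)
  qed
  have "b \<notin> I \<or> b \<notin> J"
    using assms(1) rep_tgt_neq[of e e "I \<inter> J" a b] by auto
  then show ?thesis
    using *[of I J] *[of J I] assms by (metis Int_commute)
qed

text \<open>Two vertices in normal form for \<open>I \<inter> J\<close> that are identified by both \<open>I\<close> and \<open>J\<close> are equal: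
  the deeper of them is left at its depth by \<open>I\<close> or by \<open>J\<close>, which confines the other one to the
  same subdivided edge.\<close>

lemma rep_inter_eq:
  assumes "rep (I \<inter> J) v = v" "rep (I \<inter> J) w = w" "depth w \<le> depth v"
    and "rep I v = rep I w" "rep J v = rep J w"
  shows "w = v"
proof (cases v)
  case Root then show ?thesis using assms by (cases w) auto
next
  case (Leaf m)
  then show ?thesis
  proof (cases w)
    case (Z1 e a b) then show ?thesis using assms(3) Leaf edge_depth_pos[of e] by simp
  next
    case (Z2 e a b) then show ?thesis using assms(3) Leaf edge_depth_pos[of e] by simp
  next
    case (Z3 e a b) then show ?thesis using assms(3) Leaf edge_depth_pos[of e] by simp
  qed (use Leaf assms in \<open>auto split: if_splits\<close>)
next
  case v: (Z1 e a b)
  then show ?thesis using rep_inter_Z1 assms by auto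
next
  case v: (Z3 e a b)
  then show ?thesis using rep_inter_Z3 assms by auto
next
  case v: (Z2 e a b)
  have d: "depth w \<le> Suc (edge_depth e)" using v assms(3) by simp
  have *: "w = Z2 e a b \<or> w = Z1 e a b \<or> w = Z3 e a b"
    if "a \<notin> K \<or> b \<notin> K" "rep K (Z2 e a b) = rep K w" for K
    using that rep_eq_Z2[of K w e a b] rep_eq_Z1[of K w e a b] rep_eq_Z3[of K w e a b] d
    by (auto split: if_splits)
  have "\<not> (a \<in> I \<inter> J \<and> b \<in> I \<inter> J)"
    using assms(1) v rep_src_neq[of e e "I \<inter> J" a b] by auto
  then have "w = Z2 e a b \<or> w = Z1 e a b \<or> w = Z3 e a b"
    using *[of I] *[of J] assms v by blast
  then show ?thesis
    using rep_inter_Z1[of I J e a b v] rep_inter_Z3[of I J e a b v] assms v by auto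
qed

text \<open>By \<open>rep_rep\<close>, passing to normal forms for \<open>I \<inter> J\<close>
  changes neither the class under \<open>I\<close> nor that under \<open>J\<close>, so
  \<open>rep_inter_eq\<close> applies with the deeper normal form first.\<close>

lemma theta_inter:
  assumes "ideal I" "ideal J"
  shows "theta (I \<inter> J) = theta I \<inter> theta J"
proof
  show "theta (I \<inter> J) \<subseteq> theta I \<inter> theta J"
    using assms theta_mono by (metis Int_subset_iff inf_le1 inf_le2)
  have IJ: "ideal (I \<inter> J)"
    using assms unfolding ideal_def by blast
  have "rep (I \<inter> J) v = rep (I \<inter> J) w"
    if "wfv v" "wfv w" "rep I v = rep I w" "rep J v = rep J w" for v w
  proof -
    let ?v = "rep (I \<inter> J) v" and ?w = "rep (I \<inter> J) w"
    have "rep I ?v = rep I ?w" "rep J ?v = rep J ?w"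
      using that assms rep_rep[of I "I \<inter> J"] rep_rep[of J "I \<inter> J"] by auto
    moreover have "rep (I \<inter> J) ?v = ?v" "rep (I \<inter> J) ?w = ?w"
      using rep_idem IJ that by auto
    ultimately show ?thesis
      using rep_inter_eq[of I J ?v ?w] rep_inter_eq[of I J ?w ?v] nle_le by metis
  qed
  then show "theta I \<inter> theta J \<subseteq> theta (I \<inter> J)"
    unfolding theta_def by auto
qed

text \<open>Every reduction made by \<open>rep\<close> follows edges with labels in
  \<open>K\<close>. Hence an equivalence containing these edges contains \<open>theta K\<close>,
  which is how joins are bounded.\<close>

lemma rep_connected:
  assumes \<Theta>: "equiv (Collect wfv) \<Theta>"
    and edge: "\<And>e. wfe e \<Longrightarrow> cost e \<in> K \<Longrightarrow> (src e, tgt e) \<in> \<Theta>"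
  shows "wfv v \<Longrightarrow> (v, rep K v) \<in> \<Theta>"
  using edge
proof (induction K v rule: rep.induct)
  have rfl: "(v, v) \<in> \<Theta>" if "wfv v" for v
    using \<Theta> that by (auto simp: equiv_def refl_on_def)
  have flip: "(v, w) \<in> \<Theta> \<Longrightarrow> (w, v) \<in> \<Theta>" for v w
    using \<Theta> by (auto simp: equiv_def dest: symD)
  have tr: "(u, v) \<in> \<Theta> \<Longrightarrow> (v, w) \<in> \<Theta> \<Longrightarrow> (u, w) \<in> \<Theta>" for u v w
    using \<Theta> by (auto simp: equiv_def dest: transD)
  {
    case (1 K) then show ?case by (simp add: rfl)
  next
    case (2 K m) then show ?case using 2(2)[of "Base m"] by (auto intro: rfl flip)
  next
    case (3 K e a b)
    then have "wfe (E1 e a b)" by simp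
    then have "a \<in> K \<Longrightarrow> (Z1 e a b, src e) \<in> \<Theta>"
      using 3(3)[of "E1 e a b"] flip by simp
    moreover have "a \<in> K \<Longrightarrow> (src e, rep K (src e)) \<in> \<Theta>"
      using 3 wfv_ends by simp
    ultimately have "a \<in> K \<Longrightarrow> (Z1 e a b, rep K (src e)) \<in> \<Theta>"
      using tr by blast
    then show ?case using rfl[OF 3(2)] by simp
  next
    case (4 K e a b)
    then have "wfe (E1 e a b)" "wfe (E2 e a b)" "wfe (E3 e a b)" by auto
    then have "b \<in> K \<Longrightarrow> (Z1 e a b, Z2 e a b) \<in> \<Theta>" and 23: "a \<in> K \<Longrightarrow> (Z2 e a b, Z3 e a b) \<in> \<Theta>"
      and "a \<in> K \<Longrightarrow> (src e, Z1 e a b) \<in> \<Theta>"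
      using 4(3)[of "E1 e a b"] 4(3)[of "E2 e a b"] 4(3)[of "E3 e a b"] by auto
    then have 21: "b \<in> K \<Longrightarrow> (Z2 e a b, Z1 e a b) \<in> \<Theta>" and "a \<in> K \<Longrightarrow> (Z1 e a b, src e) \<in> \<Theta>"
      by (blast dest: flip)+
    moreover have "a \<in> K \<Longrightarrow> b \<in> K \<Longrightarrow> (src e, rep K (src e)) \<in> \<Theta>"
      using 4 wfv_ends by auto
    ultimately have "a \<in> K \<Longrightarrow> b \<in> K \<Longrightarrow> (Z2 e a b, rep K (src e)) \<in> \<Theta>"
      using tr by blast
    then show ?case using 21 23 rfl[OF 4(2)] by simp
  next
    case (5 K e a b)
    then have "wfe (E4 e a b)" by simp
    then have "b \<in> K \<Longrightarrow> (Z3 e a b, tgt e) \<in> \<Theta>"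
      using 5(3)[of "E4 e a b"] by simp
    moreover have "b \<in> K \<Longrightarrow> (tgt e, rep K (tgt e)) \<in> \<Theta>"
      using 5 wfv_ends by simp
    ultimately have "b \<in> K \<Longrightarrow> (Z3 e a b, rep K (tgt e)) \<in> \<Theta>"
      using tr by blast
    then show ?case using rfl[OF 5(2)] by simp
  }
qed

text \<open>An edge with label below \<open>jn i j\<close> carries the glued path i, j, i, j, whose
  links lie alternately in \<open>theta I\<close> and \<open>theta J\<close>. The alternatives
  \<open>c \<in> I\<close> and \<open>c \<in> J\<close> serve labels whose only decompositions
  involve elements outside \<open>M\<close>.\<close>

lemma theta_join:
  assumes "ideal I" "ideal J" "ideal K" "I \<subseteq> K" "J \<subseteq> K"
    and split: "\<And>c. c \<in> K \<Longrightarrow> c \<in> M \<Longrightarrow>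
      c \<in> I \<or> c \<in> J \<or> (\<exists>i j. i \<in> I \<and> i \<in> M \<and> j \<in> J \<and> j \<in> M \<and> le c (jn i j))"
  shows "theta K = (theta I \<union> theta J)\<^sup>+"
proof
  let ?T = "(theta I \<union> theta J)\<^sup>+"
  have "theta I \<union> theta J \<subseteq> theta K"
    using assms theta_mono by simp
  then have "?T \<subseteq> (theta K)\<^sup>+"
    using trancl_mono by blast
  also have "\<dots> = theta K"
    using equiv_theta[of K] by (simp add: equiv_def)
  finally show "?T \<subseteq> theta K" .
  have "sym (theta I \<union> theta J)"
    using equiv_theta by (metis equiv_def sym_Un)
  moreover have "refl_on (Collect wfv) (theta I \<union> theta J)" "?T \<subseteq> Collect wfv \<times> Collect wfv"
    using equiv_theta by (auto simp: equiv_def refl_on_def intro!: trancl_subset_Sigma)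
  ultimately have T: "equiv (Collect wfv) ?T"
    by (auto simp: equiv_def refl_on_def sym_trancl)
  have "(src e, tgt e) \<in> ?T" if e: "wfe e" "cost e \<in> K" for e
  proof -
    have "cost e \<in> M" using e cost_in by simp
    then consider "cost e \<in> I" | "cost e \<in> J"
      | i j where "i \<in> I" "i \<in> M" "j \<in> J" "j \<in> M" "le (cost e) (jn i j)"
      using split e(2) by blast
    then show ?thesis
    proof cases
      case 3
      then have w: "wfe (E1 e i j)" "wfe (E2 e i j)" "wfe (E3 e i j)" "wfe (E4 e i j)"
        using e by auto
      have "(src e, Z1 e i j) \<in> theta I" "(Z1 e i j, Z2 e i j) \<in> theta J"
        "(Z2 e i j, Z3 e i j) \<in> theta I" "(Z3 e i j, tgt e) \<in> theta J"
        using theta_edge[OF _ w(1), of I] theta_edge[OF _ w(2), of J] theta_edge[OF _ w(3), of I]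
          theta_edge[OF _ w(4), of J] 3 assms(1,2) by simp_all
      then have "(src e, Z1 e i j) \<in> ?T" "(Z1 e i j, Z2 e i j) \<in> ?T"
        "(Z2 e i j, Z3 e i j) \<in> ?T" "(Z3 e i j, tgt e) \<in> ?T"
        by blast+
      then show ?thesis by (rule trancl_trans[OF trancl_trans[OF trancl_trans]])
    next
      case 1 then show ?thesis using theta_edge[OF assms(1) e(1)] by blast
    next
      case 2 then show ?thesis using theta_edge[OF assms(2) e(1)] by blast
    qed
  qed
  then have "(v, rep K v) \<in> ?T" if "wfv v" for v
    using rep_connected[OF T] that by blast
  then have "(v, w) \<in> ?T" if "wfv v" "wfv w" "rep K v = rep K w" for v w
    using that equivE[OF T] by (metis symD transD)
  then show "theta K \<subseteq> ?T"
    unfolding theta_def[of K] by blast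
qed

lemma theta_Id:
  assumes "M \<inter> I = {}"
  shows "theta I = Id_on (Collect wfv)"
proof -
  have "rep I v = v" if "wfv v" for v
    using that assms by (cases v) auto
  then show ?thesis unfolding theta_def by auto
qed

lemma theta_UNIV:
  assumes "M \<subseteq> I"
  shows "theta I = Collect wfv \<times> Collect wfv"
proof -
  have "wfv v \<Longrightarrow> rep I v = Root" for v
    using assms by (induction I v rule: rep.induct) (use wfv_ends in auto)
  then show ?thesis unfolding theta_def by auto
qed

text \<open>The base edges form a star with one ray for each label, so the pair of
  \<open>Leaf m\<close> and \<open>Root\<close> tests membership of \<open>m\<close>.\<close>

lemma theta_subset_imp:
  assumes "theta I \<subseteq> theta J"
  shows "I \<inter> M \<subseteq> J"
proof
  fix m assume "m \<in> I \<inter> M"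
  then have "(Leaf m, Root) \<in> theta I"
    by (auto simp: theta_def)
  then have "(Leaf m, Root) \<in> theta J"
    using assms by blast
  then show "m \<in> J" by (auto simp: theta_def split: if_splits)
qed

end

section \<open>The ideal of a term\<close>

lemma approx_gen [simp]: "approx \<Phi> (gen i R) = gen i (trunc \<Phi> R)"
  by (simp add: gen_def)

lemma upper_gen [simp]: "upper i (gen i R) = Some R" and lower_gen [simp]: "lower i (gen i R) = Some R"
  by (auto simp: gen_def)

lemma valid_gen [simp]: "valid_term (gen i R) \<longleftrightarrow> R \<in> EqL"
  by (simp add: gen_def)

lemma gen_le: "R \<subseteq> S \<Longrightarrow> le (gen i R) (gen i S)"
  by (rule le_cover[of i]) auto

text \<open>One \<open>\<Phi>\<close> for all generators loses nothing: a finitely supported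
  equivalence below \<open>R\<close> is contained in the truncation of \<open>R\<close> to its
  support.\<close>

definition below :: "('a rel + 'a rel) lterm \<Rightarrow> ('a rel + 'a rel) lterm set" where
  "below t = {m. valid_term m \<and> (\<exists>\<Phi>. finite \<Phi> \<and> le m (approx \<Phi> t))}"

lemma approx_below: "finite \<Phi> \<Longrightarrow> approx \<Phi> t \<in> below t"
  unfolding below_def using le_refl by auto

lemma below_le: "m \<in> below t \<Longrightarrow> valid_term k \<Longrightarrow> le k m \<Longrightarrow> k \<in> below t"
  unfolding below_def using le_trans valid_approx by blast

lemma below_finite_directed:
  assumes "m \<in> below t" "k \<in> below s"
  shows "\<exists>\<Phi>. finite \<Phi> \<and> le m (approx \<Phi> t) \<and> le k (approx \<Phi> s)"
proof -
  obtain \<Phi> \<Psi> where *: "finite \<Phi>" "le m (approx \<Phi> t)" "finite \<Psi>" "le k (approx \<Psi> s)"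
    using assms by (auto simp: below_def)
  have "le m (approx (\<Phi> \<union> \<Psi>) t)" "le k (approx (\<Phi> \<union> \<Psi>) s)"
    using le_trans[OF *(2) approx_mono[of \<Phi> "\<Phi> \<union> \<Psi>"]] le_trans[OF *(4) approx_mono[of \<Psi> "\<Phi> \<union> \<Psi>"]]
    by auto
  then show ?thesis using * by blast
qed

lemma below_subsetI: "(\<And>\<Phi>. finite \<Phi> \<Longrightarrow> approx \<Phi> t \<in> below s) \<Longrightarrow> below t \<subseteq> below s"
  using below_le unfolding below_def[of t] by blast

lemma below_subset_approx: "(\<And>\<Phi>. le (approx \<Phi> t) (approx \<Phi> s)) \<Longrightarrow> below t \<subseteq> below s"
  by (rule below_subsetI) (auto simp: below_def)

lemma below_Meet: "below (Meet t s) = below t \<inter> below s"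
proof
  show "below (Meet t s) \<subseteq> below t \<inter> below s"
    by (auto simp: below_def le_Meet_iff)
  show "below t \<inter> below s \<subseteq> below (Meet t s)"
  proof
    fix m assume m: "m \<in> below t \<inter> below s"
    then obtain \<Phi> where "finite \<Phi>" "le m (approx \<Phi> t)" "le m (approx \<Phi> s)"
      using below_finite_directed[of m t m s] by blast
    then show "m \<in> below (Meet t s)"
      using m by (auto simp: below_def le_Meet_iff)
  qed
qed

lemma below_Join: "m \<in> below (Join t s) \<longleftrightarrow>
    valid_term m \<and> (\<exists>a\<in>below t. \<exists>b\<in>below s. le m (Join a b))"
proof
  assume "m \<in> below (Join t s)"
  then obtain \<Phi> where "valid_term m" "finite \<Phi>" "le m (Join (approx \<Phi> t) (approx \<Phi> s))"
    by (auto simp: below_def)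
  then show "valid_term m \<and> (\<exists>a\<in>below t. \<exists>b\<in>below s. le m (Join a b))"
    using approx_below by blast
next
  assume "valid_term m \<and> (\<exists>a\<in>below t. \<exists>b\<in>below s. le m (Join a b))"
  then obtain a b where ab: "valid_term m" "a \<in> below t" "b \<in> below s" "le m (Join a b)"
    by blast
  then obtain \<Phi> where "finite \<Phi>" "le a (approx \<Phi> t)" "le b (approx \<Phi> s)"
    using below_finite_directed[of a t b s] by blast
  then have "le m (Join (approx \<Phi> t) (approx \<Phi> s))"
    using le_trans[OF ab(4) le_Join_mono] ab(2,3) by (simp add: below_def)
  then show "m \<in> below (Join t s)"
    using ab(1) \<open>finite \<Phi>\<close> by (auto simp: below_def)
qed

text \<open>Truncation does not commute with joins, since a chain between points of
  \<open>\<Phi>\<close> may leave \<open>\<Phi>\<close>. But only finitely many pairs are concerned,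
  so some finite \<open>\<Psi>\<close> contains chains for all of them. Hence the table for joins
  holds for ideals, not at each level.\<close>

lemma below_gen_join:
  assumes R: "R \<in> EqL" and S: "S \<in> EqL"
  shows "below (Join (gen i R) (gen i S)) = below (gen i (eq_join R S))"
proof
  have J: "eq_join R S \<in> EqL" using eq_join_EqL R S .
  have "trunc \<Phi> R \<subseteq> trunc \<Phi> (eq_join R S)" "trunc \<Phi> S \<subseteq> trunc \<Phi> (eq_join R S)" for \<Phi>
    using R S J by (auto simp: trunc_def eq_join_def)
  then show "below (Join (gen i R) (gen i S)) \<subseteq> below (gen i (eq_join R S))"
    by (intro below_subset_approx) (simp add: le_Join_left gen_le)
  let ?F = "\<lambda>\<Psi>. eq_join (trunc \<Psi> R) (trunc \<Psi> S)"
  have mono: "?F \<Psi> \<subseteq> ?F \<Psi>'" if "\<Psi> \<subseteq> \<Psi>'" for \<Psi> \<Psi>'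
    using that by (intro eq_join_mono trunc_mono)
  have pt: "\<exists>\<Psi>. finite \<Psi> \<and> p \<in> ?F \<Psi>" if "p \<in> eq_join R S" for p
  proof -
    have *: "\<exists>\<Psi>. finite \<Psi> \<and> p \<in> trunc \<Psi> Q" if "p \<in> Q" "Q \<in> EqL" for p and Q :: "'a rel"
      using that by (intro exI[of _ "{fst p, snd p}"]) (auto simp: trunc_def)
    have "\<exists>\<Psi>. finite \<Psi> \<and> (fst p, snd p) \<in> ?F \<Psi>"
      by (rule eq_join_approx[of _ _ R S]; (rule *[OF _ R] *[OF _ S] trunc_mono)?) (simp add: that)
    then show ?thesis by simp
  qed
  have fin: "\<exists>\<Psi>. finite \<Psi> \<and> P \<subseteq> ?F \<Psi>" if "finite P" "P \<subseteq> eq_join R S" for P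
    using that
  proof (induction P rule: finite_induct)
    case empty then show ?case by blast
  next
    case (insert p P)
    then obtain \<Psi> \<Psi>' where "finite \<Psi>" "P \<subseteq> ?F \<Psi>" "finite \<Psi>'" "p \<in> ?F \<Psi>'"
      using pt[of p] by auto
    then show ?case
      using mono[of \<Psi> "\<Psi> \<union> \<Psi>'"] mono[of \<Psi>' "\<Psi> \<union> \<Psi>'"]
      by (intro exI[of _ "\<Psi> \<union> \<Psi>'"]) auto
  qed
  show "below (gen i (eq_join R S)) \<subseteq> below (Join (gen i R) (gen i S))"
  proof (rule below_subsetI)
    fix \<Phi> :: "'a set" assume "finite \<Phi>"
    then obtain \<Psi> where \<Psi>: "finite \<Psi>" "eq_join R S \<inter> \<Phi> \<times> \<Phi> \<subseteq> ?F \<Psi>"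
      using fin[of "eq_join R S \<inter> \<Phi> \<times> \<Phi>"] by auto
    have "Id \<subseteq> ?F \<Psi>"
      by (intro EqL_D(1) eq_join_EqL trunc_EqL)
    then have "trunc \<Phi> (eq_join R S) \<subseteq> ?F \<Psi>"
      using \<Psi>(2) by (auto simp: trunc_def)
    then have "le (gen i (trunc \<Phi> (eq_join R S))) (Join (gen i (trunc \<Psi> R)) (gen i (trunc \<Psi> S)))"
      by (intro le_cover[of i]) auto
    then show "approx \<Phi> (gen i (eq_join R S)) \<in> below (Join (gen i R) (gen i S))"
      using \<Psi>(1) by (auto simp: below_def trunc_EqL)
  qed
qed

lemma below_gen_meet:
  assumes R: "R \<in> EqL" and S: "S \<in> EqL"
  shows "below (Meet (gen i R) (gen i S)) = below (gen i (eq_meet R S))"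
proof -
  have "eq_meet R S \<in> EqL" using eq_meet_EqL R S .
  then have *: "trunc \<Phi> (eq_meet R S) = eq_meet (trunc \<Phi> R) (trunc \<Phi> S)" for \<Phi>
    using R S by (auto simp: trunc_def eq_meet_def)
  show ?thesis
  proof
    show "below (Meet (gen i R) (gen i S)) \<subseteq> below (gen i (eq_meet R S))"
      by (intro below_subset_approx le_cover[of i]) (auto simp: *)
    show "below (gen i (eq_meet R S)) \<subseteq> below (Meet (gen i R) (gen i S))"
      by (intro below_subset_approx, unfold approx_simps approx_gen *)
        (auto simp: eq_meet_def intro!: le_Meet_right gen_le)
  qed
qed

lemma coprod_eq_imp_below_eq: "coprod_eq t s \<Longrightarrow> below t = below s"
proof (induction rule: coprod_eq.induct)
  case (ce_join t t' s s')
  then show ?case by (auto simp: below_Join)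
next
  case (ce_join_comm t s)
  show ?case by (intro equalityI below_subset_approx) (auto intro: le.intros le_refl)
next
  case (ce_join_assoc t s u)
  show ?case
    by (intro equalityI below_subset_approx)
      (simp_all add: le_Join_iff le_upper1 le_upper2 le_Join_right1 le_Join_right2)
next
  case (ce_join_idem t)
  show ?case by (intro equalityI below_subset_approx) (auto intro: le.intros le_refl)
next
  case (ce_absorb1 t s)
  show ?case
    by (intro equalityI below_subset_approx) (simp_all add: le_Join_left le_refl le_lower1 le_upper1)
next
  case (ce_absorb2 t s)
  show ?case
    by (intro equalityI below_subset_approx) (simp_all add: le_Meet_right le_refl le_lower1 le_upper1)
next
  case (ce_inl_join R S)
  then show ?case using below_gen_join[of R S True] by (simp add: gen_def)
next
  case (ce_inl_meet R S)
  then show ?case using below_gen_meet[of R S True] by (simp add: gen_def)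
next
  case (ce_inr_join R S)
  then show ?case using below_gen_join[of R S False] by (simp add: gen_def)
next
  case (ce_inr_meet R S)
  then show ?case using below_gen_meet[of R S False] by (simp add: gen_def)
qed (auto simp: below_Meet)

text \<open>Each approximation of \<open>t\<close> lies below some approximation of
  \<open>s\<close>, hence below \<open>s\<close>; so no finite set witnesses a failure of
  \<open>le t s\<close>.\<close>

lemma below_subset_imp_coprod_le:
  assumes "valid_term t" "valid_term s" "below t \<subseteq> below s"
  shows "coprod_le t s"
proof -
  have "le (approx \<Phi> t) s" if \<Phi>: "finite \<Phi>" for \<Phi>
  proof -
    have "approx \<Phi> t \<in> below s"
      using approx_below[OF \<Phi>] assms(3) by blast
    then obtain \<Psi> where "le (approx \<Phi> t) (approx \<Psi> s)"
      by (auto simp: below_def)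
    then show ?thesis
      using le_trans[OF _ approx_le[OF assms(2)] valid_approx assms(2)] by blast
  qed
  then have "le t s" using not_le_approx[OF assms(1,2)] by blast
  then show ?thesis using assms(1,2) by (rule le_imp_coprod_le)
qed

section \<open>Bottom, top and the choice of labels\<close>

lemma trunc_Id [simp]: "trunc \<Phi> Id = Id"
  by (auto simp: trunc_def)

lemma below_bot: "m \<in> below coprod_bot \<longleftrightarrow> valid_term m \<and> le m coprod_bot"
  by (auto simp: below_def coprod_bot_def)

lemma bot_le: "valid_term t \<Longrightarrow> le coprod_bot t"
proof (induction t)
  case (Gen g)
  then have "Id \<subseteq> carrier_rel g" by (simp add: EqL_D(1))
  then show ?case
    unfolding coprod_bot_def
    by (cases g) (simp_all add: le_Meet_left1[OF le_Gen] le_Meet_left2[OF le_Gen])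
qed (auto intro: le.intros)

lemma valid_bot: "valid_term coprod_bot"
  by (simp add: coprod_bot_def Id_EqL)

lemma below_bot_le: "m \<in> below coprod_bot \<Longrightarrow> valid_term t \<Longrightarrow> le m t"
  unfolding below_bot using le_trans[OF _ bot_le valid_bot] by blast

lemma below_bot_subset: "below coprod_bot \<subseteq> below t"
  using below_bot_le[OF _ valid_approx, of _ "{}" t] by (auto simp: below_def[of t] below_bot)

text \<open>This is why labels are taken among approximations: if Omega is infinite, the valid term
  \<open>gen True UNIV\<close> lies below no approximation of the top.\<close>

lemma approx_below_top: "finite \<Phi> \<Longrightarrow> approx \<Phi> t \<in> below coprod_top"
proof -
  assume "finite \<Phi>"
  moreover have "le (approx \<Phi> t) (approx \<Phi> coprod_top)"
  proof (induction t)
    case (Gen g)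
    have "trunc \<Phi> R \<subseteq> trunc \<Phi> UNIV" for R
      using UNIV_EqL by (auto simp: trunc_def)
    then show ?case
      unfolding coprod_top_def
      by (cases g) (simp_all add: le_Join_right1[OF le_Gen] le_Join_right2[OF le_Gen])
  qed (auto intro: le.intros)
  ultimately show ?thesis by (auto simp: below_def)
qed

text \<open>Leaving out the labels equivalent to the bottom makes the least ideal act as the identity.\<close>

definition labels :: "('a rel + 'a rel) lterm set" where
  "labels = {approx \<Phi> t |\<Phi> t. finite \<Phi>} - below coprod_bot"

text \<open>Validity is built into the order because \<open>below t\<close> is downward closed among
  valid terms only.\<close>

interpretation join_labels "\<lambda>t s. valid_term t \<and> valid_term s \<and> le t s" Join labels .

lemma ideal_below: "ideal (below t)"
  unfolding ideal_def
proof (intro conjI allI ballI impI)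
  fix x y assume "x \<in> below t" "y \<in> below t"
  then show "Join x y \<in> below t"
    using below_finite_directed[of x t y t] by (auto simp: below_def intro: le_Join_left)
qed (use below_le in blast)

lemma theta_below_Meet: "theta (below (Meet t s)) = theta (below t) \<inter> theta (below s)"
  by (simp add: below_Meet theta_inter ideal_below)

lemma theta_below_Join: "theta (below (Join t s)) = (theta (below t) \<union> theta (below s))\<^sup>+"
proof (rule theta_join)
  show "below t \<subseteq> below (Join t s)" "below s \<subseteq> below (Join t s)"
    by (rule below_subset_approx, simp add: le_upper1 le_upper2)+
  fix c assume "c \<in> below (Join t s)"
  then obtain \<Phi> where c: "valid_term c" "finite \<Phi>" "le c (Join (approx \<Phi> t) (approx \<Phi> s))"
    by (auto simp: below_def)
  \<comment> \<open>An approximation equivalent to the bottom is no label and cannot mark a glued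
    path; but then the other joinand alone bounds \<open>c\<close>.\<close>
  have absorb: "c \<in> below v"
    if "approx \<Phi> u \<in> below coprod_bot" "le c (Join (approx \<Phi> u) (approx \<Phi> v))" for u v
  proof -
    have "le (Join (approx \<Phi> u) (approx \<Phi> v)) (approx \<Phi> v)"
      using below_bot_le[OF that(1) valid_approx] by (rule le_Join_left) (rule le_refl)
    then have "le c (approx \<Phi> v)"
      by (rule le_trans[OF that(2)]) simp_all
    then show ?thesis using c(1,2) unfolding below_def by blast
  qed
  have swap: "le c (Join (approx \<Phi> s) (approx \<Phi> t))"
    by (rule le_trans[OF c(3) le_Join_left[OF le_upper2 le_upper1]]) simp_all
  show "c \<in> below t \<or> c \<in> below s \<or> (\<exists>i j. i \<in> below t \<and> i \<in> labels \<and> j \<in> below s \<and>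
      j \<in> labels \<and> valid_term c \<and> valid_term (Join i j) \<and> le c (Join i j))"
  proof (cases "approx \<Phi> t \<in> below coprod_bot \<or> approx \<Phi> s \<in> below coprod_bot")
    case True
    then show ?thesis using absorb[of t s] absorb[of s t] c(3) swap by blast
  next
    case False
    then have "approx \<Phi> t \<in> labels" "approx \<Phi> s \<in> labels"
      using c(2) by (auto simp: labels_def)
    then show ?thesis
      using c(1,3) approx_below[OF c(2)]
      by (intro disjI2 exI[of _ "approx \<Phi> t"] exI[of _ "approx \<Phi> s"]) simp
  qed
qed (rule ideal_below)+

text \<open>The relations see labels only; the approximations that are not labels lie below the
  bottom, hence in every ideal \<open>below s\<close>.\<close>

lemma theta_below_subset_imp:
  assumes "theta (below t) \<subseteq> theta (below s)"
  shows "below t \<subseteq> below s"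
proof (rule below_subsetI)
  fix \<Phi> :: "'a set" assume "finite \<Phi>"
  then have "approx \<Phi> t \<in> below t" "approx \<Phi> t \<in> labels \<or> approx \<Phi> t \<in> below coprod_bot"
    by (auto simp: labels_def approx_below)
  then show "approx \<Phi> t \<in> below s"
    using theta_subset_imp[OF assms] below_bot_subset by blast
qed

section \<open>Cardinality\<close>

lemma ex_inj_list:
  assumes "infinite (UNIV :: 'a set)"
  shows "\<exists>p :: 'a list \<Rightarrow> 'a. inj p"
proof -
  obtain q :: "'a \<times> 'a \<Rightarrow> 'a" where q: "inj q"
    using card_of_Times_same_infinite[OF assms] card_of_ordIso[of "UNIV :: ('a \<times> 'a) set" "UNIV :: 'a set"]
    by (auto simp: bij_betw_def)
  obtain n :: "nat \<Rightarrow> 'a" where n: "inj n"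
    using infinite_countable_subset[OF assms] by blast
  \<comment> \<open>Folding the pairing from the default \<open>n 0\<close> separates only lists of
    equal length, so the length is coded as well.\<close>
  define f where "f = rec_list (n 0) (\<lambda>x _ r. q (x, r))"
  have f: "length xs = length ys \<Longrightarrow> f xs = f ys \<Longrightarrow> xs = ys" for xs ys
    by (induction xs ys rule: list_induct2) (auto simp: f_def dest: injD[OF q])
  have "inj (\<lambda>xs. q (n (length xs), f xs))"
    by (rule injI) (auto dest!: injD[OF q] injD[OF n] intro: f)
  then show ?thesis by blast
qed

text \<open>The constructors are told apart by the lengths of the lists: hence the repeated entries.\<close>

primrec term_code :: "('a list \<Rightarrow> 'a) \<Rightarrow> ('g \<Rightarrow> 'a) \<Rightarrow> 'g lterm \<Rightarrow> 'a" where
  "term_code p k (Gen g) = p [k g]"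
| "term_code p k (Join t s) = p [term_code p k t, term_code p k s]"
| "term_code p k (Meet t s) = p [term_code p k t, term_code p k s, term_code p k s]"

primrec edge_code :: "('a list \<Rightarrow> 'a) \<Rightarrow> ('m \<Rightarrow> 'a) \<Rightarrow> 'm edge \<Rightarrow> 'a" where
  "edge_code p k (Base m) = p [k m]"
| "edge_code p k (E1 e a b) = p [edge_code p k e, k a, k b]"
| "edge_code p k (E2 e a b) = p [edge_code p k e, k a, k b, k b]"
| "edge_code p k (E3 e a b) = p [edge_code p k e, k a, k b, k b, k b]"
| "edge_code p k (E4 e a b) = p [edge_code p k e, k a, k b, k b, k b, k b]"

primrec vertex_code :: "('a list \<Rightarrow> 'a) \<Rightarrow> ('m \<Rightarrow> 'a) \<Rightarrow> 'm vertex \<Rightarrow> 'a" where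
  "vertex_code p k Root = p []"
| "vertex_code p k (Leaf m) = p [k m]"
| "vertex_code p k (Z1 e a b) = p [edge_code p k e, k a, k b]"
| "vertex_code p k (Z2 e a b) = p [edge_code p k e, k a, k b, k b]"
| "vertex_code p k (Z3 e a b) = p [edge_code p k e, k a, k b, k b, k b]"

lemma term_code_inj:
  assumes "inj p" "inj_on k G"
  shows "set_lterm t \<subseteq> G \<Longrightarrow> set_lterm s \<subseteq> G \<Longrightarrow> term_code p k t = term_code p k s \<Longrightarrow> t = s"
proof (induction t arbitrary: s)
  case (Gen g) then show ?case using assms by (cases s) (auto dest: injD inj_onD)
next
  case (Join t1 t2) then show ?case using assms(1) by (cases s) (auto dest!: injD[of p])
next
  case (Meet t1 t2) then show ?case using assms(1) by (cases s) (auto dest!: injD[of p])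
qed

lemma (in join_labels) edge_code_inj:
  assumes "inj p" "inj_on k M"
  shows "wfe e \<Longrightarrow> wfe f \<Longrightarrow> edge_code p k e = edge_code p k f \<Longrightarrow> e = f"
proof (induction e arbitrary: f)
qed (case_tac [!] f; use assms in \<open>auto dest!: injD[of p] dest: inj_onD\<close>)+

lemma (in join_labels) vertex_code_inj:
  assumes "inj p" "inj_on k M"
  shows "inj_on (vertex_code p k) (Collect wfv)"
proof (rule inj_onI)
  fix v w assume *: "v \<in> Collect wfv" "w \<in> Collect wfv" "vertex_code p k v = vertex_code p k w"
  have e: "wfe e \<Longrightarrow> wfe f \<Longrightarrow> edge_code p k e = edge_code p k f \<Longrightarrow> e = f" for e f
    using edge_code_inj assms .
  show "v = w"
    using * by (cases v; cases w) (auto dest!: injD[OF assms(1)] dest: e inj_onD[OF assms(2)])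
qed

text \<open>A reflexive relation is determined by its pairs off the diagonal, here a finite list.
  This is where the cardinality drops to that of Omega.\<close>

lemma inj_on_finite_rel:
  assumes p: "inj (p :: 'a list \<Rightarrow> 'a)"
  shows "\<exists>k :: 'a rel \<Rightarrow> 'a. inj_on k {R. Id \<subseteq> R \<and> finite (R - Id)}"
proof -
  define l where "l R = (SOME xs. set xs = R - Id)" for R :: "'a rel"
  have l: "set (l R) = R - Id" if "finite (R - Id)" for R
    unfolding l_def using someI_ex[OF finite_list[OF that]] .
  let ?q = "\<lambda>(x, y). p [x, y]"
  have q: "inj ?q"
    using injD[OF p] by (fastforce simp: inj_def)
  have "inj_on (\<lambda>R. p (map ?q (l R))) {R. Id \<subseteq> R \<and> finite (R - Id)}"
  proof (rule inj_onI)
    fix R S assume *: "R \<in> {R. Id \<subseteq> R \<and> finite (R - Id)}" "S \<in> {R. Id \<subseteq> R \<and> finite (R - Id)}"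
      and "p (map ?q (l R)) = p (map ?q (l S))"
    then have "l R = l S"
      using injD[OF p] inj_map_eq_map[OF q] by blast
    then have "R - Id = S - Id" using * l[of R] l[of S] by simp
    then show "R = S" using * by blast
  qed
  then show ?thesis by blast
qed

lemma approx_generators:
  assumes "finite \<Phi>"
  shows "set_lterm (approx \<Phi> t) \<subseteq> Inl ` {R. Id \<subseteq> R \<and> finite (R - Id)} \<union> Inr ` {R. Id \<subseteq> R \<and> finite (R - Id)}"
proof (induction t)
  case (Gen g)
  have "trunc \<Phi> R \<subseteq> Id \<union> \<Phi> \<times> \<Phi>" for R
    by (auto simp: trunc_def)
  then have "trunc \<Phi> R - Id \<subseteq> \<Phi> \<times> \<Phi>" for R
    by blast
  then have "finite (trunc \<Phi> R - Id)" for R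
    using assms finite_subset by (metis finite_cartesian_product)
  moreover have "Id \<subseteq> trunc \<Phi> R" for R
    by (auto simp: trunc_def)
  ultimately show ?case by (cases g) auto
qed auto

lemma labels_inj:
  assumes p: "inj (p :: 'a list \<Rightarrow> 'a)"
  shows "\<exists>k :: _ \<Rightarrow> 'a. inj_on k (labels :: ('a rel + 'a rel) lterm set)"
proof -
  let ?F = "{R :: 'a rel. Id \<subseteq> R \<and> finite (R - Id)}"
  obtain k :: "'a rel \<Rightarrow> 'a" where k: "inj_on k ?F"
    using inj_on_finite_rel[OF p] by blast
  define k' where "k' g = (case g of Inl R \<Rightarrow> p [k R] | Inr R \<Rightarrow> p [k R, k R])" for g
  have k': "inj_on k' (Inl ` ?F \<union> Inr ` ?F)"
    by (auto simp: inj_on_def k'_def dest!: injD[OF p] inj_onD[OF k])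
  have "inj_on (term_code p k') labels"
  proof (rule inj_onI)
    fix t s :: "('a rel + 'a rel) lterm"
    assume *: "t \<in> labels" "s \<in> labels" "term_code p k' t = term_code p k' s"
    have "set_lterm u \<subseteq> Inl ` ?F \<union> Inr ` ?F" if "u \<in> labels" for u
      using that approx_generators by (auto simp only: labels_def)
    then show "t = s" using term_code_inj[OF p k'] * by blast
  qed
  then show ?thesis by blast
qed

lemma ex_bij_vertices:
  assumes "infinite (UNIV :: 'a set)"
  shows "\<exists>\<psi> :: 'a \<Rightarrow> ('a rel + 'a rel) lterm vertex. bij_betw \<psi> UNIV (Collect wfv)"
proof -
  obtain p :: "'a list \<Rightarrow> 'a" where p: "inj p"
    using ex_inj_list[OF assms] by blast
  obtain k :: "('a rel + 'a rel) lterm \<Rightarrow> 'a" where k: "inj_on k labels"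
    using labels_inj[OF p] by blast
  define c :: 'a where "c = undefined"
  \<comment> \<open>Leaves give the injection from Omega. Truncating \<open>UNIV\<close> to a fixed
    point \<open>c\<close> and \<open>x\<close> yields distinct relations, with \<open>Id\<close>
    for \<open>x = c\<close>. Even that one is a label: the bottom of the left factor is not below
    that of the right one.\<close>
  define g where "g x = Leaf (approx {c, x} (gen True UNIV))" for x :: 'a
  have "inj g"
  proof (rule injI)
    fix x y assume "g x = g y"
    then have "trunc {c, x} UNIV = trunc {c, y} UNIV"
      by (simp add: g_def gen_def)
    then have "Id \<union> {c, x} \<times> {c, x} = Id \<union> {c, y} \<times> {c, y}"
      by (simp add: trunc_def UNIV_EqL)
    then show "x = y" by blast
  qed
  moreover have "wfv (g x)" for x
  proof -
    have "\<not> le (gen True R) coprod_bot" for R :: "'a rel"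
    proof
      assume "le (gen True R) coprod_bot"
      then have "le (gen True R) (Gen (Inr Id))"
        unfolding coprod_bot_def by (simp add: le_Meet_iff Id_EqL)
      then show False
        using le_upper[of "gen True R" "Gen (Inr Id)" False] by (auto simp: gen_def Id_EqL)
    qed
    then have "approx {c, x} (gen True UNIV) \<notin> below coprod_bot"
      by (simp add: below_bot)
    then have "approx {c, x} (gen True UNIV) \<in> labels"
      unfolding labels_def by blast
    then show ?thesis by (simp add: g_def)
  qed
  ultimately show ?thesis
    using Schroeder_Bernstein[of g UNIV "Collect wfv" "vertex_code p k"] vertex_code_inj[OF p k]
    by auto
qed

section \<open>Transport to Omega\<close>

lemma trancl_inv_image:
  assumes "S \<subseteq> range f \<times> range f" "inj f"
  shows "(inv_image S f)\<^sup>+ = inv_image (S\<^sup>+) f"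
proof
  have "(x, y) \<in> (inv_image S f)\<^sup>+ \<Longrightarrow> (f x, f y) \<in> S\<^sup>+" for x y
    by (induction rule: trancl_induct) (auto intro: trancl_into_trancl)
  then show "(inv_image S f)\<^sup>+ \<subseteq> inv_image (S\<^sup>+) f" by auto
  have "(f x, z) \<in> S\<^sup>+ \<Longrightarrow> z = f y \<Longrightarrow> (x, y) \<in> (inv_image S f)\<^sup>+" for x y z
  proof (induction arbitrary: y rule: trancl_induct)
    case (base z)
    then show ?case by (auto intro: r_into_trancl)
  next
    case (step z w)
    \<comment> \<open>The intermediate points of a chain in \<open>S\<close> lie in the range of
      \<open>f\<close>, so the chain pulls back link by link.\<close>
    then obtain u where "z = f u" using assms(1) by auto
    then have "(x, u) \<in> (inv_image S f)\<^sup>+" "(u, y) \<in> inv_image S f"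
      using step by auto
    then show ?case by (rule trancl_into_trancl)
  qed
  then show "inv_image (S\<^sup>+) f \<subseteq> (inv_image S f)\<^sup>+" by auto
qed

theorem theorem6p4:
  assumes "infinite (UNIV :: 'a set)"
  shows "\<exists>h :: ('a rel + 'a rel) lterm \<Rightarrow> 'a rel. coprod_01_embedding h"
proof -
  obtain \<psi> :: "'a \<Rightarrow> ('a rel + 'a rel) lterm vertex" where \<psi>: "bij_betw \<psi> UNIV (Collect wfv)"
    using ex_bij_vertices[OF assms] by blast
  then have inj: "inj \<psi>" and range: "range \<psi> = Collect wfv"
    by (auto simp: bij_betw_def)
  have wf: "wfv (\<psi> x)" for x using range by blast
  have theta_range: "theta (below t) \<subseteq> range \<psi> \<times> range \<psi>" for t
    by (auto simp: theta_def range)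
  define h where "h t = inv_image (theta (below t)) \<psi>" for t
  have EqL: "h t \<in> EqL" for t
    using wf by (auto simp: h_def theta_def EqL_def equiv_def refl_on_def sym_def trans_def)
  have subset: "theta (below t) \<subseteq> theta (below s)" if "h t \<subseteq> h s" for t s
  proof
    fix q assume q: "q \<in> theta (below t)"
    then obtain x y where xy: "q = (\<psi> x, \<psi> y)" using theta_range by blast
    then have "(x, y) \<in> h t" using q by (simp add: h_def)
    then have "(x, y) \<in> h s" using that by blast
    then show "q \<in> theta (below s)" using xy by (simp add: h_def)
  qed
  have eq_iff: "h t = h s \<longleftrightarrow> coprod_eq t s" if "valid_term t" "valid_term s" for t s
  proof
    assume "h t = h s"
    then have "below t \<subseteq> below s" "below s \<subseteq> below t"
      by (simp_all add: theta_below_subset_imp subset)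
    then show "coprod_eq t s"
      using that by (intro coprod_le_antisym below_subset_imp_coprod_le)
  next
    assume "coprod_eq t s"
    then show "h t = h s" by (simp add: h_def coprod_eq_imp_below_eq)
  qed
  have join: "h (Join t s) = eq_join (h t) (h s)" for t s
  proof -
    have "h (Join t s) = (inv_image (theta (below t) \<union> theta (below s)) \<psi>)\<^sup>+"
      unfolding h_def theta_below_Join using theta_range inj
      by (intro trancl_inv_image[symmetric]) auto
    also have "inv_image (theta (below t) \<union> theta (below s)) \<psi> = h t \<union> h s"
      by (auto simp: h_def)
    finally show ?thesis by (simp add: eq_join_def)
  qed
  have meet: "h (Meet t s) = eq_meet (h t) (h s)" for t s
    by (auto simp: h_def theta_below_Meet eq_meet_def)
  have "theta (below coprod_bot :: ('a rel + 'a rel) lterm set) = Id_on (Collect wfv)"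
    by (rule theta_Id) (auto simp: labels_def)
  then have bot: "h coprod_bot = Id"
    using wf by (auto simp: h_def inj_eq[OF inj])
  have "theta (below coprod_top :: ('a rel + 'a rel) lterm set) = Collect wfv \<times> Collect wfv"
    by (rule theta_UNIV) (auto simp: labels_def approx_below_top)
  then have top: "h coprod_top = UNIV"
    using wf by (auto simp: h_def)
  have "coprod_01_embedding h"
    unfolding coprod_01_embedding_def by (simp add: EqL eq_iff join meet bot top)
  then show ?thesis by blast
qed

end
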